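(* Let $A$ be a bounded pseudo-BCK algebra. The following statements are equivalent: (a) $A$ admits a Bosbach state; (b) there exists a normal filter $F\ne A$ of $A$ such that $A/F$ is termwise equivalent to an MV-algebra; (c) there exists a normal and maximal filter $F$ of $A$ such that $A/F$ is termwise equivalent to an MV-algebra.
   Context: A pseudo-BCK algebra is a structure $(A,\le,\rightarrow,\rightsquigarrow,1)$ with $\le$ a binary relation, $\rightarrow,\rightsquigarrow$ binary operations and $1\in A$, such that for all $x,y,z\in A$: $x\rightarrow y\le (y\rightarrow z)\rightsquigarrow(x\rightarrow z)$ and $x\rightsquigarrow y\le (y\rightsquigarrow z)\rightarrow(x\rightsquigarrow z)$; $x\le (x\rightarrow y)\rightsquigarrow y$ and $x\le (x\rightsquigarrow y)\rightarrow y$; $x\le x$; $x\le 1$; antisymmetry of $\le$; $x\le y$ iff $x\rightarrow y=1$ iff $x\rightsquigarrow y=1$. It is bounded if it has a least element $0$. A filter is a set $F\ni 1$ with $a,a\rightarrow b\in F\Rightarrow b\in F$; normal if $a\rightarrow b\in F\iff a\rightsquigarrow b\in F$; maximal if proper and not properly contained in another proper filter. For a normal filter $F$, $A/F$ is the quotient pseudo-BCK algebra by the congruence $a\Theta_F b\iff a\rightarrow b,\,b\rightarrow a\in F$. An MV-algebra $(M,\oplus,{}^-,0,1)$ yields a bounded pseudo-BCK algebra with $x\rightarrow y=x\rightsquigarrow y=x^-\oplus y$; "termwise equivalent to an MV-algebra" refers to this correspondence. A Bosbach state is a map $s:A\to[0,1]$ with $s(x)+s(x\rightarrow y)=s(y)+s(y\rightarrow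 x)$, $s(x)+s(x\rightsquigarrow y)=s(y)+s(y\rightsquigarrow x)$ for all $x,y$, $s(0)=0$, $s(1)=1$. *)

theory Defs
  imports Complex_Main "HOL-Algebra.Congruence"
begin

record 'a pseudo_bck = "'a partial_object" +
  ple  :: "'a \<Rightarrow> 'a \<Rightarrow> bool"  (infix "\<preceq>\<index>" 50)
  pimp :: "'a \<Rightarrow> 'a \<Rightarrow> 'a"     (infixr "\<rightharpoondown>\<index>" 65)
  wimp :: "'a \<Rightarrow> 'a \<Rightarrow> 'a"     (infixr "\<leadsto>\<index>" 65)
  pone :: 'a                  ("\<one>\<index>")

text \<open>The least element is a field of the record; it is uniquely determined by the order.\<close>

record 'a bounded_pseudo_bck = "'a pseudo_bck" +
  pzero :: 'a                 ("\<zero>\<index>")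

locale pseudo_BCK =
  fixes A :: "('a, 'm) pseudo_bck_scheme" (structure)
  assumes pimp_closed: "\<lbrakk>x \<in> carrier A; y \<in> carrier A\<rbrakk> \<Longrightarrow> x \<rightharpoondown> y \<in> carrier A"
    and wimp_closed: "\<lbrakk>x \<in> carrier A; y \<in> carrier A\<rbrakk> \<Longrightarrow> x \<leadsto> y \<in> carrier A"
    and one_closed: "\<one> \<in> carrier A"
    and pimp_trans: "\<lbrakk>x \<in> carrier A; y \<in> carrier A; z \<in> carrier A\<rbrakk>
          \<Longrightarrow> x \<rightharpoondown> y \<preceq> (y \<rightharpoondown> z) \<leadsto> (x \<rightharpoondown> z)"
    and wimp_trans: "\<lbrakk>x \<in> carrier A; y \<in> carrier A; z \<in> carrier A\<rbrakk>
          \<Longrightarrow> x \<leadsto> y \<preceq> (y \<leadsto> z) \<rightharpoondown> (x \<leadsto> z)"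
    and pimp_mp: "\<lbrakk>x \<in> carrier A; y \<in> carrier A\<rbrakk> \<Longrightarrow> x \<preceq> (x \<rightharpoondown> y) \<leadsto> y"
    and wimp_mp: "\<lbrakk>x \<in> carrier A; y \<in> carrier A\<rbrakk> \<Longrightarrow> x \<preceq> (x \<leadsto> y) \<rightharpoondown> y"
    and le_refl: "x \<in> carrier A \<Longrightarrow> x \<preceq> x"
    and le_one: "x \<in> carrier A \<Longrightarrow> x \<preceq> \<one>"
    and le_antisym: "\<lbrakk>x \<in> carrier A; y \<in> carrier A; x \<preceq> y; y \<preceq> x\<rbrakk> \<Longrightarrow> x = y"
    and le_iff_pimp: "\<lbrakk>x \<in> carrier A; y \<in> carrier A\<rbrakk> \<Longrightarrow> x \<preceq> y \<longleftrightarrow> x \<rightharpoondown> y = \<one>"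
    and le_iff_wimp: "\<lbrakk>x \<in> carrier A; y \<in> carrier A\<rbrakk> \<Longrightarrow> x \<preceq> y \<longleftrightarrow> x \<leadsto> y = \<one>"

locale bounded_pseudo_BCK = pseudo_BCK A
  for A :: "('a, 'm) bounded_pseudo_bck_scheme" (structure) +
  assumes zero_closed: "\<zero> \<in> carrier A"
    and zero_le: "x \<in> carrier A \<Longrightarrow> \<zero> \<preceq> x"

definition pbck_filter :: "('a, 'm) pseudo_bck_scheme \<Rightarrow> 'a set \<Rightarrow> bool" where
  "pbck_filter A F \<longleftrightarrow> F \<subseteq> carrier A \<and> \<one>\<^bsub>A\<^esub> \<in> F \<and>
     (\<forall>a\<in>carrier A. \<forall>b\<in>carrier A. a \<in> F \<and> a \<rightharpoondown>\<^bsub>A\<^esub> b \<in> F \<longrightarrow> b \<in> F)"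

definition normal_filter :: "('a, 'm) pseudo_bck_scheme \<Rightarrow> 'a set \<Rightarrow> bool" where
  "normal_filter A F \<longleftrightarrow> pbck_filter A F \<and>
     (\<forall>a\<in>carrier A. \<forall>b\<in>carrier A. a \<rightharpoondown>\<^bsub>A\<^esub> b \<in> F \<longleftrightarrow> a \<leadsto>\<^bsub>A\<^esub> b \<in> F)"

definition maximal_filter :: "('a, 'm) pseudo_bck_scheme \<Rightarrow> 'a set \<Rightarrow> bool" where
  "maximal_filter A F \<longleftrightarrow> pbck_filter A F \<and> F \<noteq> carrier A \<and>
     \<not> (\<exists>G. pbck_filter A G \<and> G \<noteq> carrier A \<and> F \<subset> G)"

definition filter_rel :: "('a, 'm) pseudo_bck_scheme \<Rightarrow> 'a set \<Rightarrow> ('a \<times> 'a) set" where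
  "filter_rel A F = {(a, b). a \<in> carrier A \<and> b \<in> carrier A \<and>
     a \<rightharpoondown>\<^bsub>A\<^esub> b \<in> F \<and> b \<rightharpoondown>\<^bsub>A\<^esub> a \<in> F}"

text \<open>
  The operations on congruence classes are written as unions over representatives. When
  \<open>F\<close> is a normal filter, \<open>filter_rel A F\<close> is a congruence, so all the classes in such
  a union coincide. The order on classes is \<open>a/F \<preceq> b/F \<longleftrightarrow> a \<rightharpoondown> b \<in> F\<close>, which
  likewise does not depend on the representatives.
\<close>

definition quotient_pbck ::
  "('a, 'm) bounded_pseudo_bck_scheme \<Rightarrow> 'a set \<Rightarrow> 'a set bounded_pseudo_bck" where
  "quotient_pbck A F =
     \<lparr> carrier = carrier A // filter_rel A F,
       ple = (\<lambda>X Y. \<exists>a\<in>X. \<exists>b\<in>Y. a \<rightharpoondown>\<^bsub>A\<^esub> b \<in> F),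
       pimp = (\<lambda>X Y. \<Union>a\<in>X. \<Union>b\<in>Y. filter_rel A F `` {a \<rightharpoondown>\<^bsub>A\<^esub> b}),
       wimp = (\<lambda>X Y. \<Union>a\<in>X. \<Union>b\<in>Y. filter_rel A F `` {a \<leadsto>\<^bsub>A\<^esub> b}),
       pone = filter_rel A F `` {\<one>\<^bsub>A\<^esub>},
       pzero = filter_rel A F `` {\<zero>\<^bsub>A\<^esub>} \<rparr>"

record 'a mv = "'a partial_object" +
  mv_add  :: "'a \<Rightarrow> 'a \<Rightarrow> 'a"  (infixl "\<oplus>\<index>" 65)
  mv_neg  :: "'a \<Rightarrow> 'a"
  mv_zero :: 'a
  mv_one  :: 'a

locale MV_algebra =
  fixes M :: "('a, 'm) mv_scheme" (structure)
  assumes add_closed: "\<lbrakk>x \<in> carrier M; y \<in> carrier M\<rbrakk> \<Longrightarrow> x \<oplus> y \<in> carrier M"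
    and neg_closed: "x \<in> carrier M \<Longrightarrow> mv_neg M x \<in> carrier M"
    and mv_zero_closed: "mv_zero M \<in> carrier M"
    and mv_one_closed: "mv_one M \<in> carrier M"
    and add_assoc: "\<lbrakk>x \<in> carrier M; y \<in> carrier M; z \<in> carrier M\<rbrakk>
          \<Longrightarrow> (x \<oplus> y) \<oplus> z = x \<oplus> (y \<oplus> z)"
    and add_comm: "\<lbrakk>x \<in> carrier M; y \<in> carrier M\<rbrakk> \<Longrightarrow> x \<oplus> y = y \<oplus> x"
    and add_zero: "x \<in> carrier M \<Longrightarrow> x \<oplus> mv_zero M = x"
    and neg_neg: "x \<in> carrier M \<Longrightarrow> mv_neg M (mv_neg M x) = x"
    and neg_zero: "mv_neg M (mv_zero M) = mv_one M"
    and add_one: "x \<in> carrier M \<Longrightarrow> x \<oplus> mv_one M = mv_one M"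
    and lukasiewicz: "\<lbrakk>x \<in> carrier M; y \<in> carrier M\<rbrakk>
          \<Longrightarrow> mv_neg M (mv_neg M x \<oplus> y) \<oplus> y = mv_neg M (mv_neg M y \<oplus> x) \<oplus> x"

definition pbck_of_mv :: "('a, 'm) mv_scheme \<Rightarrow> 'a bounded_pseudo_bck" where
  "pbck_of_mv M =
     \<lparr> carrier = carrier M,
       ple = (\<lambda>x y. mv_neg M x \<oplus>\<^bsub>M\<^esub> y = mv_one M),
       pimp = (\<lambda>x y. mv_neg M x \<oplus>\<^bsub>M\<^esub> y),
       wimp = (\<lambda>x y. mv_neg M x \<oplus>\<^bsub>M\<^esub> y),
       pone = mv_one M,
       pzero = mv_zero M \<rparr>"

text \<open>Equality as structures; values of the record fields outside the carrier are ignored.\<close>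

definition same_pbck ::
  "('a, 'm) bounded_pseudo_bck_scheme \<Rightarrow> ('a, 'n) bounded_pseudo_bck_scheme \<Rightarrow> bool" where
  "same_pbck A B \<longleftrightarrow> carrier A = carrier B \<and> \<one>\<^bsub>A\<^esub> = \<one>\<^bsub>B\<^esub> \<and> \<zero>\<^bsub>A\<^esub> = \<zero>\<^bsub>B\<^esub> \<and>
     (\<forall>x\<in>carrier A. \<forall>y\<in>carrier A.
        (x \<preceq>\<^bsub>A\<^esub> y \<longleftrightarrow> x \<preceq>\<^bsub>B\<^esub> y) \<and>
        x \<rightharpoondown>\<^bsub>A\<^esub> y = x \<rightharpoondown>\<^bsub>B\<^esub> y \<and> x \<leadsto>\<^bsub>A\<^esub> y = x \<leadsto>\<^bsub>B\<^esub> y)"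

text \<open>
  The MV-operations are then terms of the pseudo-BCK algebra: \<open>mv_neg M x = x \<rightharpoondown> \<zero>\<close> and
  \<open>x \<oplus> y = (x \<rightharpoondown> \<zero>) \<rightharpoondown> y\<close>, so the correspondence is a term equivalence in both directions.
\<close>

definition termwise_equiv_MV :: "('a, 'm) bounded_pseudo_bck_scheme \<Rightarrow> bool" where
  "termwise_equiv_MV A \<longleftrightarrow> (\<exists>M :: 'a mv. MV_algebra M \<and> same_pbck A (pbck_of_mv M))"

definition bosbach_state ::
  "('a, 'm) bounded_pseudo_bck_scheme \<Rightarrow> ('a \<Rightarrow> real) \<Rightarrow> bool" where
  "bosbach_state A s \<longleftrightarrow>
     (\<forall>x\<in>carrier A. 0 \<le> s x \<and> s x \<le> 1) \<and>
     (\<forall>x\<in>carrier A. \<forall>y\<in>carrier A.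
        s x + s (x \<rightharpoondown>\<^bsub>A\<^esub> y) = s y + s (y \<rightharpoondown>\<^bsub>A\<^esub> x) \<and>
        s x + s (x \<leadsto>\<^bsub>A\<^esub> y) = s y + s (y \<leadsto>\<^bsub>A\<^esub> x)) \<and>
     s \<zero>\<^bsub>A\<^esub> = 0 \<and> s \<one>\<^bsub>A\<^esub> = 1"

end

theory Submission
  imports Defs
begin

text \<open>
  The kernel of a Bosbach state \<open>s\<close> is a normal filter, and \<open>s\<close> descends to a faithful state
  on the quotient. Faithfulness makes both joins \<open>(x \<rightharpoondown> y) \<leadsto> y\<close> and
  \<open>(x \<leadsto> y) \<rightharpoondown> y\<close> commutative. To identify the two implications, localize the state
  at \<open>q\<close> by taking the supremum of \<open>s\<close> over the iterated implications
  \<open>q \<rightharpoondown> \<dots> \<rightharpoondown> q \<rightharpoondown> x\<close>. A localized state is real-valued and still satisfies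
  Bosbach's identity, so it cannot distinguish \<open>u = x \<rightharpoondown> y\<close> from \<open>v = x \<leadsto> y\<close>;
  choosing \<open>q = u \<rightharpoondown> v\<close> and using prelinearity yields \<open>v \<preceq> u\<close>, hence \<open>u = v\<close>.

  The quotient by a filter containing \<open>F\<close> inherits commutativity from \<open>A/F\<close>, so \<open>F\<close> can be
  enlarged to a maximal filter by Zorn's lemma. The quotient is then an MV-chain, and a state on
  an MV-chain is given by rotation numbers of the translations of Chang's ordered group.
\<close>

section \<open>Arithmetic of pseudo-BCK algebras\<close>

context pseudo_BCK
begin

declare pimp_closed [simp, intro] wimp_closed [simp, intro] one_closed [simp, intro]
  le_refl [simp] le_one [simp]

lemma one_le_iff [simp]: "x \<in> carrier A \<Longrightarrow> \<one> \<preceq> x \<longleftrightarrow> x = \<one>"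
  using le_antisym le_one le_refl one_closed by blast

text \<open>Transitivity is not among the axioms. When \<open>x \<rightharpoondown> y\<close> and
  \<open>y \<rightharpoondown> z\<close> are \<open>\<one>\<close>, \<open>pimp_trans\<close>
  shrinks to \<open>\<one> \<preceq> \<one> \<leadsto> (x \<rightharpoondown> z)\<close>, and
  nothing but \<open>\<one>\<close> lies above \<open>\<one>\<close>.\<close>

lemma le_trans [trans]:
  assumes "x \<preceq> y" "y \<preceq> z" and [simp]: "x \<in> carrier A" "y \<in> carrier A" "z \<in> carrier A"
  shows "x \<preceq> z"
proof -
  have "\<one> \<preceq> \<one> \<leadsto> (x \<rightharpoondown> z)"
    using pimp_trans[of x y z] assms by (simp add: le_iff_pimp)
  then have "\<one> \<preceq> x \<rightharpoondown> z"
    using le_iff_wimp[of \<one> "x \<rightharpoondown> z"] by simp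
  then show ?thesis by (simp add: le_iff_pimp[of x z])
qed

lemma pimp_anti:
  assumes "x \<preceq> y" and [simp]: "x \<in> carrier A" "y \<in> carrier A" "z \<in> carrier A"
  shows "y \<rightharpoondown> z \<preceq> x \<rightharpoondown> z"
  using pimp_trans[of x y z] assms(1) le_iff_pimp[of x y] le_iff_wimp[of "y \<rightharpoondown> z"] by simp

lemma wimp_anti:
  assumes "x \<preceq> y" and [simp]: "x \<in> carrier A" "y \<in> carrier A" "z \<in> carrier A"
  shows "y \<leadsto> z \<preceq> x \<leadsto> z"
  using wimp_trans[of x y z] assms(1) le_iff_wimp[of x y] le_iff_pimp[of "y \<leadsto> z"] by simp

text \<open>The two implications into a fixed \<open>z\<close> form an antitone Galois connection:
  each direction composes an antitone law with a unit, \<open>pimp_mp\<close> or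
  \<open>wimp_mp\<close>.\<close>

lemma le_pimp_iff:
  assumes [simp]: "x \<in> carrier A" "y \<in> carrier A" "z \<in> carrier A"
  shows "x \<preceq> y \<rightharpoondown> z \<longleftrightarrow> y \<preceq> x \<leadsto> z"
proof
  assume "x \<preceq> y \<rightharpoondown> z"
  then have "(y \<rightharpoondown> z) \<leadsto> z \<preceq> x \<leadsto> z" by (rule wimp_anti) auto
  with pimp_mp[of y z] show "y \<preceq> x \<leadsto> z" by (rule le_trans) auto
next
  assume "y \<preceq> x \<leadsto> z"
  then have "(x \<leadsto> z) \<rightharpoondown> z \<preceq> y \<rightharpoondown> z" by (rule pimp_anti) auto
  with wimp_mp[of x z] show "x \<preceq> y \<rightharpoondown> z" by (rule le_trans) auto
qed

text \<open>Each inequality is a transitivity law followed by antitonicity along a unit of the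
  Galois connection.\<close>

lemma exchange:
  assumes [simp]: "x \<in> carrier A" "y \<in> carrier A" "z \<in> carrier A"
  shows "x \<rightharpoondown> (y \<leadsto> z) = y \<leadsto> (x \<rightharpoondown> z)"
proof (rule le_antisym)
  have "((y \<leadsto> z) \<rightharpoondown> z) \<leadsto> (x \<rightharpoondown> z) \<preceq> y \<leadsto> (x \<rightharpoondown> z)"
    by (rule wimp_anti) (simp_all add: wimp_mp)
  with pimp_trans[of x "y \<leadsto> z" z] show "x \<rightharpoondown> (y \<leadsto> z) \<preceq> y \<leadsto> (x \<rightharpoondown> z)"
    by (rule le_trans) auto
  have "((x \<rightharpoondown> z) \<leadsto> z) \<rightharpoondown> (y \<leadsto> z) \<preceq> x \<rightharpoondown> (y \<leadsto> z)"
    by (rule pimp_anti) (simp_all add: pimp_mp)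
  with wimp_trans[of y "x \<rightharpoondown> z" z] show "y \<leadsto> (x \<rightharpoondown> z) \<preceq> x \<rightharpoondown> (y \<leadsto> z)"
    by (rule le_trans) auto
qed auto

lemma pimp_pimp_mono:
  assumes [simp]: "x \<in> carrier A" "y \<in> carrier A" "z \<in> carrier A"
  shows "x \<rightharpoondown> y \<preceq> (z \<rightharpoondown> x) \<rightharpoondown> (z \<rightharpoondown> y)"
  using pimp_trans[of z x y] by (simp add: le_pimp_iff)

lemma wimp_wimp_mono:
  assumes [simp]: "x \<in> carrier A" "y \<in> carrier A" "z \<in> carrier A"
  shows "x \<leadsto> y \<preceq> (z \<leadsto> x) \<leadsto> (z \<leadsto> y)"
  using wimp_trans[of z x y] by (simp flip: le_pimp_iff)

lemma pimp_mono:
  assumes "x \<preceq> y" and [simp]: "x \<in> carrier A" "y \<in> carrier A" "z \<in> carrier A"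
  shows "z \<rightharpoondown> x \<preceq> z \<rightharpoondown> y"
  using pimp_pimp_mono[of x y z] assms(1) le_iff_pimp[of x y] le_iff_pimp[of "z \<rightharpoondown> x"] by simp

lemma pimp_self [simp]: "x \<in> carrier A \<Longrightarrow> x \<rightharpoondown> x = \<one>"
  using le_iff_pimp[of x x] by simp

lemma wimp_self [simp]: "x \<in> carrier A \<Longrightarrow> x \<leadsto> x = \<one>"
  using le_iff_wimp[of x x] by simp

lemma pimp_one [simp]: "x \<in> carrier A \<Longrightarrow> x \<rightharpoondown> \<one> = \<one>"
  using le_iff_pimp[of x \<one>] by simp

lemma wimp_one [simp]: "x \<in> carrier A \<Longrightarrow> x \<leadsto> \<one> = \<one>"
  using le_iff_wimp[of x \<one>] by simp

lemma le_pimp [simp]: "\<lbrakk>x \<in> carrier A; y \<in> carrier A\<rbrakk> \<Longrightarrow> x \<preceq> y \<rightharpoondown> x"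
  by (simp add: le_pimp_iff)

lemma le_wimp [simp]: "\<lbrakk>x \<in> carrier A; y \<in> carrier A\<rbrakk> \<Longrightarrow> x \<preceq> y \<leadsto> x"
  by (simp flip: le_pimp_iff)

lemma one_pimp [simp]:
  assumes [simp]: "x \<in> carrier A"
  shows "\<one> \<rightharpoondown> x = x"
proof -
  have "\<one> \<preceq> (\<one> \<rightharpoondown> x) \<leadsto> x" by (simp flip: le_pimp_iff)
  then have "(\<one> \<rightharpoondown> x) \<leadsto> x = \<one>" by simp
  then have "\<one> \<rightharpoondown> x \<preceq> x" by (simp add: le_iff_wimp)
  then show ?thesis by (simp add: le_antisym)
qed

lemma one_wimp [simp]:
  assumes [simp]: "x \<in> carrier A"
  shows "\<one> \<leadsto> x = x"
proof -
  have "\<one> \<preceq> (\<one> \<leadsto> x) \<rightharpoondown> x" by (simp add: le_pimp_iff)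
  then have "(\<one> \<leadsto> x) \<rightharpoondown> x = \<one>" by simp
  then have "\<one> \<leadsto> x \<preceq> x" by (simp add: le_iff_pimp)
  then show ?thesis by (simp add: le_antisym)
qed

definition join :: "'a \<Rightarrow> 'a \<Rightarrow> 'a" where
  "join x y = (x \<rightharpoondown> y) \<leadsto> y"

definition wjoin :: "'a \<Rightarrow> 'a \<Rightarrow> 'a" where
  "wjoin x y = (x \<leadsto> y) \<rightharpoondown> y"

lemma join_closed [simp, intro]: "\<lbrakk>x \<in> carrier A; y \<in> carrier A\<rbrakk> \<Longrightarrow> join x y \<in> carrier A"
  by (simp add: join_def)

lemma wjoin_closed [simp, intro]: "\<lbrakk>x \<in> carrier A; y \<in> carrier A\<rbrakk> \<Longrightarrow> wjoin x y \<in> carrier A"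
  by (simp add: wjoin_def)

lemma join_ge [simp]:
  assumes "x \<in> carrier A" "y \<in> carrier A"
  shows "x \<preceq> join x y" "y \<preceq> join x y"
  using assms by (simp_all add: join_def pimp_mp)

lemma wjoin_ge [simp]:
  assumes "x \<in> carrier A" "y \<in> carrier A"
  shows "x \<preceq> wjoin x y" "y \<preceq> wjoin x y"
  using assms by (simp_all add: wjoin_def wimp_mp)

lemma join_mono:
  assumes "x \<preceq> y" and [simp]: "x \<in> carrier A" "y \<in> carrier A" "z \<in> carrier A"
  shows "join x z \<preceq> join y z"
  unfolding join_def by (intro wimp_anti pimp_anti assms) auto

lemma wjoin_mono:
  assumes "x \<preceq> y" and [simp]: "x \<in> carrier A" "y \<in> carrier A" "z \<in> carrier A"
  shows "wjoin x z \<preceq> wjoin y z"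
  unfolding wjoin_def by (intro wimp_anti pimp_anti assms) auto

text \<open>The triple law of the Galois connection. It replaces \<open>x\<close> by an element
  above \<open>y\<close>, which reduces arbitrary pairs to comparable ones.\<close>

lemma join_pimp:
  assumes [simp]: "x \<in> carrier A" "y \<in> carrier A"
  shows "join x y \<rightharpoondown> y = x \<rightharpoondown> y"
proof (rule le_antisym)
  show "join x y \<rightharpoondown> y \<preceq> x \<rightharpoondown> y" by (rule pimp_anti) auto
  show "x \<rightharpoondown> y \<preceq> join x y \<rightharpoondown> y" by (simp add: le_pimp_iff join_def)
qed auto

lemma wjoin_wimp:
  assumes [simp]: "x \<in> carrier A" "y \<in> carrier A"
  shows "wjoin x y \<leadsto> y = x \<leadsto> y"
proof (rule le_antisym)
  show "wjoin x y \<leadsto> y \<preceq> x \<leadsto> y" by (rule wimp_anti) auto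
  show "x \<leadsto> y \<preceq> wjoin x y \<leadsto> y" by (simp flip: le_pimp_iff add: wjoin_def)
qed auto

lemma join_absorb2: "\<lbrakk>x \<preceq> y; x \<in> carrier A; y \<in> carrier A\<rbrakk> \<Longrightarrow> join x y = y"
  by (simp add: join_def le_iff_pimp)

lemma wjoin_absorb2: "\<lbrakk>x \<preceq> y; x \<in> carrier A; y \<in> carrier A\<rbrakk> \<Longrightarrow> wjoin x y = y"
  by (simp add: wjoin_def le_iff_wimp)

lemma funpow_pimp_closed [simp, intro]:
  "\<lbrakk>q \<in> carrier A; x \<in> carrier A\<rbrakk> \<Longrightarrow> ((\<rightharpoondown>) q ^^ n) x \<in> carrier A"
  by (induction n) auto

lemma funpow_pimp_mono:
  assumes "x \<preceq> y" and [simp]: "q \<in> carrier A" "x \<in> carrier A" "y \<in> carrier A"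
  shows "((\<rightharpoondown>) q ^^ n) x \<preceq> ((\<rightharpoondown>) q ^^ n) y"
  by (induction n) (use assms(1) in \<open>auto intro: pimp_mono\<close>)

lemma funpow_pimp_ge:
  assumes [simp]: "q \<in> carrier A" "x \<in> carrier A"
  shows "x \<preceq> ((\<rightharpoondown>) q ^^ n) x"
proof (induction n)
  case (Suc n)
  then show ?case using le_trans[OF Suc le_pimp] by simp
qed simp

text \<open>By \<open>exchange\<close>, implications by \<open>q\<close> slide past
  \<open>x \<leadsto>\<close>; this is why \<open>localized_wimp_le\<close> treats
  \<open>\<leadsto>\<close> first.\<close>

lemma funpow_pimp_wimp:
  assumes [simp]: "q \<in> carrier A" "x \<in> carrier A" "y \<in> carrier A"
  shows "((\<rightharpoondown>) q ^^ n) (x \<leadsto> y) = x \<leadsto> ((\<rightharpoondown>) q ^^ n) y"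
  by (induction n) (simp_all add: exchange)

end

context bounded_pseudo_BCK
begin

declare zero_closed [simp, intro] zero_le [simp]

lemma zero_pimp [simp]: "x \<in> carrier A \<Longrightarrow> \<zero> \<rightharpoondown> x = \<one>"
  using le_iff_pimp[of \<zero> x] by simp

lemma zero_wimp [simp]: "x \<in> carrier A \<Longrightarrow> \<zero> \<leadsto> x = \<one>"
  using le_iff_wimp[of \<zero> x] by simp

end

section \<open>Commutative pseudo-BCK algebras and prelinearity\<close>

text \<open>These are exactly the pseudo-MV-algebras.\<close>

locale comm_pseudo_BCK = bounded_pseudo_BCK +
  assumes join_commute: "\<lbrakk>x \<in> carrier A; y \<in> carrier A\<rbrakk> \<Longrightarrow> join x y = join y x"
    and wjoin_commute: "\<lbrakk>x \<in> carrier A; y \<in> carrier A\<rbrakk> \<Longrightarrow> wjoin x y = wjoin y x"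
begin

lemma join_absorb1: "\<lbrakk>y \<preceq> x; x \<in> carrier A; y \<in> carrier A\<rbrakk> \<Longrightarrow> join x y = x"
  using join_commute join_absorb2 by metis

lemma wjoin_absorb1: "\<lbrakk>y \<preceq> x; x \<in> carrier A; y \<in> carrier A\<rbrakk> \<Longrightarrow> wjoin x y = x"
  using wjoin_commute wjoin_absorb2 by metis

lemma join_least:
  assumes "x \<preceq> z" "y \<preceq> z" and [simp]: "x \<in> carrier A" "y \<in> carrier A" "z \<in> carrier A"
  shows "join x y \<preceq> z"
  using join_mono[OF assms(1), of y] join_absorb1[OF assms(2)] by simp

lemma pimp_zero_wimp_zero [simp]: "x \<in> carrier A \<Longrightarrow> (x \<rightharpoondown> \<zero>) \<leadsto> \<zero> = x"
  using join_absorb1[of \<zero> x] by (simp add: join_def)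

text \<open>Since \<open>x\<close> is a double negation, \<open>exchange\<close> turns
  \<open>c \<rightharpoondown> x\<close> into \<open>(x \<rightharpoondown> \<zero>) \<leadsto> (c
  \<rightharpoondown> \<zero>)\<close>; the outer implication completes a \<open>wjoin\<close> whose
  second argument is the smaller one.\<close>

lemma pimp_pimp_pimp_zero:
  assumes "x \<preceq> c" and [simp]: "x \<in> carrier A" "c \<in> carrier A"
  shows "(c \<rightharpoondown> x) \<rightharpoondown> (c \<rightharpoondown> \<zero>) = x \<rightharpoondown> \<zero>"
proof -
  have "c \<rightharpoondown> x = c \<rightharpoondown> ((x \<rightharpoondown> \<zero>) \<leadsto> \<zero>)" by simp
  also have "\<dots> = (x \<rightharpoondown> \<zero>) \<leadsto> (c \<rightharpoondown> \<zero>)" by (rule exchange) auto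
  finally have "(c \<rightharpoondown> x) \<rightharpoondown> (c \<rightharpoondown> \<zero>) = wjoin (x \<rightharpoondown> \<zero>) (c \<rightharpoondown> \<zero>)"
    by (simp add: wjoin_def)
  also have "\<dots> = x \<rightharpoondown> \<zero>"
    by (rule wjoin_absorb1) (auto intro: pimp_anti assms(1))
  finally show ?thesis .
qed

text \<open>Any upper bound of \<open>x \<rightharpoondown> y\<close> and \<open>y \<rightharpoondown> x\<close> has the form \<open>c \<rightharpoondown> w\<close> with
  \<open>c = join x y\<close>, and \<open>w\<close> then dominates both \<open>x\<close> and \<open>y\<close>.\<close>

lemma prelinear:
  assumes [simp]: "x \<in> carrier A" "y \<in> carrier A"
  shows "(x \<rightharpoondown> y) \<rightharpoondown> (y \<rightharpoondown> x) = y \<rightharpoondown> x"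
proof -
  define c where "c = join x y"
  define t where "t = join (x \<rightharpoondown> y) (y \<rightharpoondown> x)"
  \<comment> \<open>\<open>v\<close> and \<open>w\<close> are chosen so that \<open>exchange\<close>
    rewrites \<open>join t (c \<rightharpoondown> \<zero>)\<close> as
    \<open>c \<rightharpoondown> w\<close>.\<close>
  define v where "v = t \<rightharpoondown> (c \<rightharpoondown> \<zero>)"
  define w where "w = v \<leadsto> \<zero>"
  have [simp]: "c \<in> carrier A" "t \<in> carrier A" "v \<in> carrier A" "w \<in> carrier A"
    by (auto simp: c_def t_def v_def w_def)
  have cy: "c \<rightharpoondown> y = x \<rightharpoondown> y" by (simp add: c_def join_pimp)
  have cx: "c \<rightharpoondown> x = y \<rightharpoondown> x"
    using join_pimp[of y x] join_commute[of x y] by (simp add: c_def)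
  have le: "x \<preceq> c" "y \<preceq> c" by (auto simp: c_def)
  have t: "c \<rightharpoondown> x \<preceq> t" "c \<rightharpoondown> y \<preceq> t" by (auto simp: t_def cx cy)
  have "c \<rightharpoondown> \<zero> \<preceq> c \<rightharpoondown> x" by (rule pimp_mono) auto
  then have "c \<rightharpoondown> \<zero> \<preceq> t" using t(1) by (rule le_trans) auto
  then have "t = join t (c \<rightharpoondown> \<zero>)" by (simp add: join_absorb1)
  also have "\<dots> = c \<rightharpoondown> w" by (simp add: join_def v_def w_def exchange)
  finally have tw: "t = c \<rightharpoondown> w" .
  \<comment> \<open>Applied to \<open>x\<close> and \<open>y\<close>, this gives
    \<open>c \<preceq> w\<close> and hence
    \<open>t = c \<rightharpoondown> w = \<one>\<close>.\<close>
  have "z \<preceq> w" if "z \<preceq> c" "c \<rightharpoondown> z \<preceq> t" and [simp]: "z \<in> carrier A" for z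
  proof -
    have "v \<preceq> (c \<rightharpoondown> z) \<rightharpoondown> (c \<rightharpoondown> \<zero>)"
      unfolding v_def by (rule pimp_anti) (use that in auto)
    then have "v \<preceq> z \<rightharpoondown> \<zero>" using that by (simp add: pimp_pimp_pimp_zero)
    then show ?thesis by (simp add: w_def le_pimp_iff)
  qed
  then have "c \<preceq> w" unfolding c_def using le t by (intro join_least) (auto simp: c_def)
  then have "t = \<one>" using tw by (simp add: le_iff_pimp)
  then have "(x \<rightharpoondown> y) \<rightharpoondown> (y \<rightharpoondown> x) \<preceq> y \<rightharpoondown> x" by (simp add: t_def join_def le_iff_wimp)
  then show ?thesis by (simp add: le_antisym)
qed

end

section \<open>Bosbach states and their kernels\<close>

locale bosbach = bounded_pseudo_BCK +
  fixes s :: "'a \<Rightarrow> real"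
  assumes state: "bosbach_state A s"
begin

lemma state_nonneg: "x \<in> carrier A \<Longrightarrow> 0 \<le> s x"
  and state_le_1: "x \<in> carrier A \<Longrightarrow> s x \<le> 1"
  and state_pimp: "\<lbrakk>x \<in> carrier A; y \<in> carrier A\<rbrakk> \<Longrightarrow> s x + s (x \<rightharpoondown> y) = s y + s (y \<rightharpoondown> x)"
  and state_wimp: "\<lbrakk>x \<in> carrier A; y \<in> carrier A\<rbrakk> \<Longrightarrow> s x + s (x \<leadsto> y) = s y + s (y \<leadsto> x)"
  and state_zero [simp]: "s \<zero> = 0"
  and state_one [simp]: "s \<one> = 1"
  using state unfolding bosbach_state_def by blast+

lemma state_pimp_le:
  assumes "y \<preceq> x" "x \<in> carrier A" "y \<in> carrier A"
  shows "s (x \<rightharpoondown> y) = 1 + s y - s x"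
  using state_pimp[of x y] assms le_iff_pimp[of y x] by simp

lemma state_wimp_le:
  assumes "y \<preceq> x" "x \<in> carrier A" "y \<in> carrier A"
  shows "s (x \<leadsto> y) = 1 + s y - s x"
  using state_wimp[of x y] assms le_iff_wimp[of y x] by simp

lemma state_mono: "\<lbrakk>x \<preceq> y; x \<in> carrier A; y \<in> carrier A\<rbrakk> \<Longrightarrow> s x \<le> s y"
  using state_pimp_le[of x y] state_le_1[of "y \<rightharpoondown> x"] by simp

lemma state_join_le:
  "\<lbrakk>y \<preceq> x; x \<in> carrier A; y \<in> carrier A\<rbrakk> \<Longrightarrow> s (join x y) = s x"
  by (simp add: join_def state_wimp_le state_pimp_le)

lemma state_wjoin_le:
  "\<lbrakk>y \<preceq> x; x \<in> carrier A; y \<in> carrier A\<rbrakk> \<Longrightarrow> s (wjoin x y) = s x"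
  by (simp add: wjoin_def state_wimp_le state_pimp_le)

text \<open>Each join is enlarged to a join of the other kind over the comparable pair formed by the
  opposite join and \<open>y\<close>; for comparable pairs both joins have the state of the larger
  element.\<close>

lemma state_wjoin:
  assumes [simp]: "x \<in> carrier A" "y \<in> carrier A"
  shows "s (wjoin x y) = s (join x y)"
proof (rule antisym)
  have "s (wjoin x y) \<le> s (wjoin (join x y) y)"
    by (intro state_mono wjoin_mono) auto
  then show "s (wjoin x y) \<le> s (join x y)" by (simp add: state_wjoin_le)
  have "s (join x y) \<le> s (join (wjoin x y) y)"
    by (intro state_mono join_mono) auto
  then show "s (join x y) \<le> s (wjoin x y)" by (simp add: state_join_le)
qed

lemma state_pimp_join:
  assumes [simp]: "x \<in> carrier A" "y \<in> carrier A"
  shows "s (x \<rightharpoondown> y) = 1 + s y - s (join x y)"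
  using state_pimp_le[of y "join x y"] by (simp add: join_pimp)

text \<open>The value agrees with that of \<open>x \<rightharpoondown> y\<close> in
  \<open>state_pimp_join\<close>. This makes the kernel normal.\<close>

lemma state_wimp_join:
  assumes [simp]: "x \<in> carrier A" "y \<in> carrier A"
  shows "s (x \<leadsto> y) = 1 + s y - s (join x y)"
  using state_wimp_le[of y "wjoin x y"] by (simp add: wjoin_wimp state_wjoin)

lemma state_join_commute:
  "\<lbrakk>x \<in> carrier A; y \<in> carrier A\<rbrakk> \<Longrightarrow> s (join x y) = s (join y x)"
  using state_pimp[of x y] by (simp add: state_pimp_join)

text \<open>\<open>join_mono\<close> covers the first argument only; symmetry of the state value
  carries it over to the second.\<close>

lemma state_join_mono:
  assumes "x \<preceq> x'" "y \<preceq> y'"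
    and [simp]: "x \<in> carrier A" "y \<in> carrier A" "x' \<in> carrier A" "y' \<in> carrier A"
  shows "s (join x y) \<le> s (join x' y')"
proof -
  have "s (join x y) \<le> s (join x' y)" by (intro state_mono join_mono assms) auto
  also have "\<dots> = s (join y x')" by (simp add: state_join_commute)
  also have "\<dots> \<le> s (join y' x')" by (intro state_mono join_mono assms) auto
  also have "\<dots> = s (join x' y')" by (simp add: state_join_commute)
  finally show ?thesis .
qed

definition kernel :: "'a set" where
  "kernel = {x \<in> carrier A. s x = 1}"

lemma normal_filter_kernel: "normal_filter A kernel"
proof -
  have "s b = 1" if "s a = 1" "s (a \<rightharpoondown> b) = 1" "a \<in> carrier A" "b \<in> carrier A" for a b
    using state_pimp[of a b] state_le_1[of b] state_le_1[of "b \<rightharpoondown> a"] that by simp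
  then show ?thesis
    by (auto simp: normal_filter_def pbck_filter_def kernel_def state_pimp_join state_wimp_join)
qed

lemma kernel_neq_carrier: "kernel \<noteq> carrier A"
  using zero_closed state_zero by (force simp: kernel_def)

end

section \<open>Faithful states: commutativity and coincidence of the implications\<close>

locale faithful_bosbach = bosbach +
  assumes faithful: "\<lbrakk>x \<in> carrier A; s x = 1\<rbrakk> \<Longrightarrow> x = \<one>"
begin

lemma eq_if_state_eq:
  "\<lbrakk>x \<preceq> y; s x = s y; x \<in> carrier A; y \<in> carrier A\<rbrakk> \<Longrightarrow> x = y"
  using faithful[of "y \<rightharpoondown> x"] state_pimp_le[of x y] le_iff_pimp[of y x] le_antisym[of x y] by simp

text \<open>Both joins lie below \<open>join (wjoin x y) y\<close> and have the same state as it, so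
  faithfulness identifies all three.\<close>

lemma join_eq_wjoin:
  assumes [simp]: "x \<in> carrier A" "y \<in> carrier A"
  shows "join x y = wjoin x y"
proof -
  have "join x y = join (wjoin x y) y"
    by (rule eq_if_state_eq) (auto intro: join_mono simp: state_join_le state_wjoin)
  moreover have "wjoin x y = join (wjoin x y) y"
    by (rule eq_if_state_eq) (auto simp: state_join_le)
  ultimately show ?thesis by simp
qed

text \<open>After \<open>exchange\<close>, the claim compares \<open>y \<rightharpoondown> x\<close>
  with the smaller element \<open>join x y \<rightharpoondown> x\<close>. Their states agree, so the
  implication between them has state 1.\<close>

lemma join_le_join_swap:
  assumes [simp]: "x \<in> carrier A" "y \<in> carrier A"
  shows "join x y \<preceq> join y x"
proof -
  have "join x y \<rightharpoondown> join y x = (y \<rightharpoondown> x) \<leadsto> (join x y \<rightharpoondown> x)"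
    by (simp add: join_def[of y x] exchange)
  moreover have "join x y \<rightharpoondown> x \<preceq> y \<rightharpoondown> x"
    by (rule pimp_anti) auto
  moreover have "s (join x y \<rightharpoondown> x) = s (y \<rightharpoondown> x)"
    by (simp add: state_pimp_le state_pimp_join[of y x] state_join_commute[of x y])
  ultimately have "s (join x y \<rightharpoondown> join y x) = 1"
    by (simp add: state_wimp_le)
  then show ?thesis using faithful by (simp add: le_iff_pimp)
qed

sublocale comm_pseudo_BCK
proof
  fix x y assume [simp]: "x \<in> carrier A" "y \<in> carrier A"
  show *: "join x y = join y x"
    by (intro le_antisym join_le_join_swap) auto
  show "wjoin x y = wjoin y x"
    using * by (simp add: join_eq_wjoin)
qed

text \<open>Localization of the state at \<open>q\<close>: the difference between \<open>localized q\<close> and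
  \<open>s\<close> is the part of the state carried by the complement of \<open>q\<close>.\<close>

definition localized :: "'a \<Rightarrow> 'a \<Rightarrow> real" where
  "localized q x = (SUP n. s (((\<rightharpoondown>) q ^^ n) x))"

lemma incseq_funpow_pimp:
  assumes [simp]: "q \<in> carrier A" "x \<in> carrier A"
  shows "incseq (\<lambda>n. s (((\<rightharpoondown>) q ^^ n) x))"
  by (rule incseq_SucI) (auto intro: state_mono)

lemma bdd_above_funpow_pimp:
  "\<lbrakk>q \<in> carrier A; x \<in> carrier A\<rbrakk> \<Longrightarrow> bdd_above (range (\<lambda>n. s (((\<rightharpoondown>) q ^^ n) x)))"
  by (rule bdd_aboveI[of _ 1]) (auto intro: state_le_1)

lemma localized_LIMSEQ:
  "\<lbrakk>q \<in> carrier A; x \<in> carrier A\<rbrakk> \<Longrightarrow> (\<lambda>n. s (((\<rightharpoondown>) q ^^ n) x)) \<longlonglongrightarrow> localized q x"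
  unfolding localized_def by (intro LIMSEQ_incseq_SUP bdd_above_funpow_pimp incseq_funpow_pimp)

lemma state_le_localized:
  "\<lbrakk>q \<in> carrier A; x \<in> carrier A\<rbrakk> \<Longrightarrow> s (((\<rightharpoondown>) q ^^ n) x) \<le> localized q x"
  unfolding localized_def by (intro cSUP_upper bdd_above_funpow_pimp) auto

lemma localized_le_1:
  "\<lbrakk>q \<in> carrier A; x \<in> carrier A\<rbrakk> \<Longrightarrow> localized q x \<le> 1"
  unfolding localized_def by (intro cSUP_least) (auto intro: state_le_1)

lemma localized_self: "q \<in> carrier A \<Longrightarrow> localized q q = 1"
  using state_le_localized[of q q 1] localized_le_1[of q q] by simp

text \<open>One implication by \<open>q\<close> raises the state of \<open>w\<close> by
  \<open>1 - s (join q w)\<close>, which is antitone in \<open>w\<close>; the increments add up over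
  the iteration.\<close>

lemma state_increment_antimono:
  assumes "x \<preceq> y" and [simp]: "q \<in> carrier A" "x \<in> carrier A" "y \<in> carrier A"
  shows "s (((\<rightharpoondown>) q ^^ n) y) - s y \<le> s (((\<rightharpoondown>) q ^^ n) x) - s x"
proof (induction n)
  case (Suc n)
  have "s (join q (((\<rightharpoondown>) q ^^ n) x)) \<le> s (join q (((\<rightharpoondown>) q ^^ n) y))"
    by (intro state_join_mono funpow_pimp_mono assms) auto
  with Suc show ?case by (simp add: state_pimp_join)
qed simp

text \<open>By \<open>z\<close>, everything depends on \<open>s (join x (?f n y))\<close>. It is at
  most \<open>s (?f n x)\<close>, and falls short of it by at most
  \<open>localized q y - s (?f n y)\<close>, which tends to 0.\<close>

lemma localized_wimp_le:
  assumes "y \<preceq> x" and [simp]: "q \<in> carrier A" "x \<in> carrier A" "y \<in> carrier A"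
  shows "localized q (x \<leadsto> y) = 1 + localized q y - localized q x"
proof -
  let ?f = "\<lambda>n. ((\<rightharpoondown>) q ^^ n)"
  have z: "s (?f n (x \<leadsto> y)) = 1 + s (?f n y) - s (join x (?f n y))" for n
    by (simp add: funpow_pimp_wimp state_wimp_join)
  have upper: "s (join x (?f n y)) \<le> s (?f n x)" for n
  proof -
    have "s (join x (?f n y)) \<le> s (join (?f n x) (?f n y))"
      by (intro state_join_mono funpow_pimp_ge) auto
    also have "\<dots> = s (?f n x)"
      by (intro state_join_le funpow_pimp_mono assms) auto
    finally show ?thesis .
  qed
  \<comment> \<open>\<open>w\<close> lies above \<open>?f n y\<close>, so \<open>n\<close> further
    implications raise the state of \<open>w\<close> by no more than that of \<open>?f n y\<close>,
    and the latter stays below the supremum \<open>localized q y\<close>.\<close>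
  have lower: "s (?f n x) + s (?f n y) \<le> localized q y + s (join x (?f n y))" for n
  proof -
    define w where "w = join x (?f n y)"
    have [simp]: "w \<in> carrier A" by (simp add: w_def)
    have "s (?f n x) - s w \<le> s (?f n w) - s w"
      by (auto simp: w_def intro!: state_mono funpow_pimp_mono)
    also have "\<dots> \<le> s (?f n (?f n y)) - s (?f n y)"
      by (rule state_increment_antimono) (auto simp: w_def)
    also have "s (?f n (?f n y)) \<le> localized q y"
      using state_le_localized[of q y "n + n"] by (simp add: funpow_add)
    finally show ?thesis by (simp add: w_def)
  qed
  have "1 + localized q y - localized q x \<le> localized q (x \<leadsto> y)"
  proof (rule LIMSEQ_le)
    show "(\<lambda>n. 1 + s (?f n y) - s (?f n x)) \<longlonglongrightarrow> 1 + localized q y - localized q x"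
      by (intro tendsto_intros localized_LIMSEQ) auto
    show "(\<lambda>n. s (?f n (x \<leadsto> y))) \<longlonglongrightarrow> localized q (x \<leadsto> y)"
      by (intro localized_LIMSEQ) auto
    show "\<exists>N. \<forall>n\<ge>N. 1 + s (?f n y) - s (?f n x) \<le> s (?f n (x \<leadsto> y))"
      using upper by (simp add: z)
  qed
  moreover have "localized q (x \<leadsto> y) \<le> 1 + localized q y - localized q x"
  proof (rule LIMSEQ_le)
    show "(\<lambda>n. 1 + localized q y - s (?f n x)) \<longlonglongrightarrow> 1 + localized q y - localized q x"
      by (intro tendsto_intros localized_LIMSEQ) auto
    show "(\<lambda>n. s (?f n (x \<leadsto> y))) \<longlonglongrightarrow> localized q (x \<leadsto> y)"
      by (intro localized_LIMSEQ) auto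
    show "\<exists>N. \<forall>n\<ge>N. s (?f n (x \<leadsto> y)) \<le> 1 + localized q y - s (?f n x)"
      using lower by (simp add: z algebra_simps)
  qed
  ultimately show ?thesis by simp
qed

lemma localized_wimp:
  assumes [simp]: "q \<in> carrier A" "x \<in> carrier A" "y \<in> carrier A"
  shows "localized q (x \<leadsto> y) = 1 + localized q y - localized q (join x y)"
  using localized_wimp_le[of y "wjoin x y" q] by (simp add: wjoin_wimp join_eq_wjoin)

text \<open>The comparable case is known for \<open>\<leadsto>\<close>. Applied to
  \<open>y \<preceq> x \<rightharpoondown> y\<close>, where
  \<open>(x \<rightharpoondown> y) \<leadsto> y\<close> is \<open>join x y\<close>, it can be solved
  for the value at \<open>x \<rightharpoondown> y\<close>.\<close>

lemma localized_pimp: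
  assumes [simp]: "q \<in> carrier A" "x \<in> carrier A" "y \<in> carrier A"
  shows "localized q (x \<rightharpoondown> y) = 1 + localized q y - localized q (join x y)"
  using localized_wimp_le[of y "x \<rightharpoondown> y" q] by (simp add: join_def)

text \<open>Localize at \<open>q = u \<rightharpoondown> v\<close>: there \<open>u \<rightharpoondown> v\<close> gets value 1, hence so does
  \<open>v \<rightharpoondown> u\<close>, on which the localized state agrees with \<open>s\<close> by prelinearity.\<close>

lemma pimp_eq_wimp:
  assumes [simp]: "x \<in> carrier A" "y \<in> carrier A"
  shows "x \<rightharpoondown> y = x \<leadsto> y"
proof -
  define u v where "u = x \<rightharpoondown> y" and "v = x \<leadsto> y"
  have [simp]: "u \<in> carrier A" "v \<in> carrier A" by (auto simp: u_def v_def)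
  define q where "q = u \<rightharpoondown> v"
  have [simp]: "q \<in> carrier A" by (simp add: q_def)
  have stable: "((\<rightharpoondown>) q ^^ n) (v \<rightharpoondown> u) = v \<rightharpoondown> u" for n
    by (induction n) (simp_all add: q_def prelinear)
  have "localized q u = localized q v"
    by (simp add: u_def v_def localized_wimp localized_pimp)
  then have "localized q (v \<rightharpoondown> u) = localized q (u \<rightharpoondown> v)"
    by (simp add: localized_pimp join_commute)
  also have "\<dots> = 1" using localized_self[of q] by (simp add: q_def)
  finally have "s (v \<rightharpoondown> u) = 1" by (simp add: localized_def stable)
  then have "v \<preceq> u" using faithful by (simp add: le_iff_pimp)
  then have "v = u"
    by (rule eq_if_state_eq) (simp_all add: u_def v_def state_pimp_join state_wimp_join)
  then show ?thesis by (simp add: u_def v_def)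
qed

end

section \<open>Wajsberg algebras and their cancellation identities\<close>

locale wajsberg = bounded_pseudo_BCK +
  assumes wimp_eq_pimp: "\<lbrakk>x \<in> carrier A; y \<in> carrier A\<rbrakk> \<Longrightarrow> x \<leadsto> y = x \<rightharpoondown> y"
    and pimp_pimp_commute:
      "\<lbrakk>x \<in> carrier A; y \<in> carrier A\<rbrakk> \<Longrightarrow> (x \<rightharpoondown> y) \<rightharpoondown> y = (y \<rightharpoondown> x) \<rightharpoondown> x"
begin

sublocale comm_pseudo_BCK
  by unfold_locales (simp_all add: join_def wjoin_def wimp_eq_pimp pimp_pimp_commute)

lemma swap:
  "\<lbrakk>x \<in> carrier A; y \<in> carrier A; z \<in> carrier A\<rbrakk> \<Longrightarrow> x \<rightharpoondown> (y \<rightharpoondown> z) = y \<rightharpoondown> (x \<rightharpoondown> z)"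
  using exchange[of x y z] by (simp add: wimp_eq_pimp)

lemma neg_neg [simp]: "x \<in> carrier A \<Longrightarrow> (x \<rightharpoondown> \<zero>) \<rightharpoondown> \<zero> = x"
  using pimp_zero_wimp_zero[of x] by (simp add: wimp_eq_pimp)

lemma pimp_pimp_absorb: "\<lbrakk>y \<preceq> x; x \<in> carrier A; y \<in> carrier A\<rbrakk> \<Longrightarrow> (x \<rightharpoondown> y) \<rightharpoondown> y = x"
  using join_absorb1[of y x] by (simp add: join_def wimp_eq_pimp)

lemma contrapos:
  assumes [simp]: "x \<in> carrier A" "y \<in> carrier A"
  shows "(y \<rightharpoondown> \<zero>) \<rightharpoondown> (x \<rightharpoondown> \<zero>) = x \<rightharpoondown> y"
  using swap[of x "y \<rightharpoondown> \<zero>" \<zero>] by simp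

lemma neg_pimp_commute:
  assumes [simp]: "x \<in> carrier A" "y \<in> carrier A"
  shows "(x \<rightharpoondown> \<zero>) \<rightharpoondown> y = (y \<rightharpoondown> \<zero>) \<rightharpoondown> x"
  using contrapos[of "x \<rightharpoondown> \<zero>" y] by simp

lemma le_neg_iff:
  assumes [simp]: "x \<in> carrier A" "y \<in> carrier A"
  shows "x \<rightharpoondown> \<zero> \<preceq> y \<rightharpoondown> \<zero> \<longleftrightarrow> y \<preceq> x"
  by (simp add: le_iff_pimp contrapos)

lemma neg_le_iff:
  assumes [simp]: "x \<in> carrier A" "y \<in> carrier A"
  shows "x \<rightharpoondown> \<zero> \<preceq> y \<longleftrightarrow> y \<rightharpoondown> \<zero> \<preceq> x"
  by (simp add: le_iff_pimp neg_pimp_commute)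

text \<open>In a lattice-ordered group with strong unit 1, \<open>a \<rightharpoondown> b\<close> is
  1 - a + b for b \<le> a, so \<open>x\<close> cancels. Contraposition makes
  \<open>x \<rightharpoondown> \<zero>\<close> a common target, where \<open>swap\<close> and
  absorption perform the cancellation.\<close>

lemma pimp_chain:
  assumes "z \<preceq> y" "y \<preceq> x" and [simp]: "x \<in> carrier A" "y \<in> carrier A" "z \<in> carrier A"
  shows "(x \<rightharpoondown> y) \<rightharpoondown> (x \<rightharpoondown> z) = y \<rightharpoondown> z"
proof -
  let ?n = "\<lambda>u. u \<rightharpoondown> \<zero>"
  have "(x \<rightharpoondown> y) \<rightharpoondown> (x \<rightharpoondown> z) = (?n y \<rightharpoondown> ?n x) \<rightharpoondown> (?n z \<rightharpoondown> ?n x)"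
    by (simp add: contrapos)
  also have "\<dots> = ?n z \<rightharpoondown> ((?n y \<rightharpoondown> ?n x) \<rightharpoondown> ?n x)"
    by (rule swap) auto
  also have "\<dots> = ?n z \<rightharpoondown> ?n y"
    using assms(2) by (simp add: pimp_pimp_absorb le_neg_iff)
  finally show ?thesis by (simp add: contrapos)
qed

text \<open>In the group reading of \<open>pimp_chain\<close>, both sides are z - y.\<close>

lemma pimp_neg_chain:
  assumes "y \<preceq> x" "x \<preceq> z" and [simp]: "x \<in> carrier A" "y \<in> carrier A" "z \<in> carrier A"
  shows "(z \<rightharpoondown> x) \<rightharpoondown> ((x \<rightharpoondown> y) \<rightharpoondown> \<zero>) = (z \<rightharpoondown> y) \<rightharpoondown> \<zero>"
proof -
  have "(z \<rightharpoondown> x) \<rightharpoondown> ((x \<rightharpoondown> y) \<rightharpoondown> \<zero>) = (x \<rightharpoondown> y) \<rightharpoondown> ((z \<rightharpoondown> x) \<rightharpoondown> \<zero>)"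
    by (rule swap) auto
  also have "\<dots> = ((z \<rightharpoondown> x) \<rightharpoondown> (z \<rightharpoondown> y)) \<rightharpoondown> ((z \<rightharpoondown> x) \<rightharpoondown> \<zero>)"
    by (simp add: pimp_chain assms(1,2))
  also have "\<dots> = (z \<rightharpoondown> y) \<rightharpoondown> \<zero>"
    by (intro pimp_pimp_pimp_zero pimp_mono assms(1)) auto
  finally show ?thesis .
qed

text \<open>In the same reading both sides are 1 - x + z - y. This value is \<open>h\<close>; since
  \<open>h \<preceq> g\<close>, the factor \<open>g\<close> cancels by
  \<open>pimp_pimp_pimp_zero\<close>.\<close>

lemma neg_pimp_chain:
  assumes "y \<preceq> z" "z \<preceq> x" and [simp]: "x \<in> carrier A" "y \<in> carrier A" "z \<in> carrier A"
  shows "((x \<rightharpoondown> z) \<rightharpoondown> y) \<rightharpoondown> \<zero> = x \<rightharpoondown> ((z \<rightharpoondown> y) \<rightharpoondown> \<zero>)"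
proof -
  let ?n = "\<lambda>u. u \<rightharpoondown> \<zero>"
  define e g h where "e = z \<rightharpoondown> y" and "g = x \<rightharpoondown> z" and "h = e \<rightharpoondown> ?n x"
  have [simp]: "e \<in> carrier A" "g \<in> carrier A" "h \<in> carrier A" by (auto simp: e_def g_def h_def)
  have "h \<preceq> ?n z \<rightharpoondown> ?n x"
    unfolding h_def by (intro pimp_anti) (auto simp: e_def intro: pimp_mono)
  then have hg: "h \<preceq> g" by (simp add: contrapos g_def)
  have "g \<rightharpoondown> y = ?n y \<rightharpoondown> ?n g" by (simp add: contrapos)
  also have "?n y = e \<rightharpoondown> ?n z"
    using pimp_pimp_pimp_zero[of y z] by (simp add: e_def assms(1))
  also have "?n z = g \<rightharpoondown> ?n x"
    using pimp_pimp_pimp_zero[of z x] by (simp add: g_def assms(2))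
  also have "e \<rightharpoondown> (g \<rightharpoondown> ?n x) = g \<rightharpoondown> h"
    unfolding h_def by (rule swap) auto
  also have "(g \<rightharpoondown> h) \<rightharpoondown> ?n g = ?n h" using hg by (simp add: pimp_pimp_pimp_zero)
  finally have "(g \<rightharpoondown> y) \<rightharpoondown> \<zero> = h" by simp
  also have "h = x \<rightharpoondown> ?n e" unfolding h_def by (rule swap) auto
  finally show ?thesis by (simp add: e_def g_def)
qed

end

section \<open>Rotation numbers on MV-chains\<close>

locale linear_wajsberg = wajsberg +
  assumes linear: "\<lbrakk>x \<in> carrier A; y \<in> carrier A\<rbrakk> \<Longrightarrow> x \<preceq> y \<or> y \<preceq> x"
    and nontrivial: "\<zero> \<noteq> \<one>"
begin

text \<open>A pair \<open>(k, c)\<close> encodes the element \<open>k - c\<close> of Chang's ordered group, whose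
  strong unit is 1, and \<open>rot x\<close> is the translation by \<open>x\<close>.\<close>

definition rot :: "'a \<Rightarrow> int \<times> 'a \<Rightarrow> int \<times> 'a" where
  "rot x p = (if snd p \<preceq> x then (fst p + 1, x \<rightharpoondown> snd p) else (fst p, (snd p \<rightharpoondown> x) \<rightharpoondown> \<zero>))"

text \<open>As \<open>k - c\<close> decreases in \<open>c\<close>, the second components are
  compared in reverse. The two codes \<open>(k, \<zero>)\<close> and \<open>(k + 1, \<one>)\<close>
  of the integer k are kept apart.\<close>

definition rot_le :: "int \<times> 'a \<Rightarrow> int \<times> 'a \<Rightarrow> bool" where
  "rot_le p q \<longleftrightarrow> fst p < fst q \<or> fst p = fst q \<and> snd q \<preceq> snd p"

lemma rot_closed [simp, intro]:
  "\<lbrakk>x \<in> carrier A; snd p \<in> carrier A\<rbrakk> \<Longrightarrow> snd (rot x p) \<in> carrier A"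
  by (simp add: rot_def)

lemma funpow_rot_closed [simp, intro]:
  "\<lbrakk>x \<in> carrier A; snd p \<in> carrier A\<rbrakk> \<Longrightarrow> snd ((rot x ^^ n) p) \<in> carrier A"
  by (induction n) auto

lemma rot_shift: "rot x (apfst ((+) j) p) = apfst ((+) j) (rot x p)"
  by (simp add: rot_def)

lemma funpow_rot_shift: "(rot x ^^ n) (apfst ((+) j) p) = apfst ((+) j) ((rot x ^^ n) p)"
  by (induction n) (simp_all add: rot_shift)

text \<open>Only translation by \<open>x\<close> wraps around at \<open>c\<close>. In either order
  exactly one wrap occurs, and \<open>neg_pimp_chain\<close> equates the remainders.\<close>

lemma rot_commute_mixed:
  assumes "c \<preceq> x" "\<not> c \<preceq> y" and [simp]: "x \<in> carrier A" "y \<in> carrier A" "c \<in> carrier A"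
  shows "rot x (rot y (k, c)) = rot y (rot x (k, c))"
proof -
  have yc: "y \<preceq> c" using assms(2) linear[of c y] by simp
  have "\<not> x \<rightharpoondown> c \<preceq> y"
    using assms(2) le_trans[of c "x \<rightharpoondown> c" y] by auto
  moreover have "(c \<rightharpoondown> y) \<rightharpoondown> \<zero> \<preceq> c" by (simp add: neg_le_iff pimp_mono)
  then have "(c \<rightharpoondown> y) \<rightharpoondown> \<zero> \<preceq> x" using assms(1) by (rule le_trans) auto
  ultimately show ?thesis
    using assms(1,2) by (simp add: rot_def neg_pimp_chain[OF yc assms(1)])
qed

lemma rot_commute:
  assumes [simp]: "x \<in> carrier A" "y \<in> carrier A" and "snd p \<in> carrier A"
  shows "rot x (rot y p) = rot y (rot x p)"
proof -
  obtain k c where p: "p = (k, c)" by (cases p)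
  have [simp]: "c \<in> carrier A" using assms(3) p by simp
  consider "c \<preceq> x" "\<not> c \<preceq> y" | "c \<preceq> y" "\<not> c \<preceq> x" | "c \<preceq> x" "c \<preceq> y" | "\<not> c \<preceq> x" "\<not> c \<preceq> y"
    by blast
  then have "rot x (rot y (k, c)) = rot y (rot x (k, c))"
  proof cases
    case 1
    then show ?thesis by (rule rot_commute_mixed) auto
  next
    case 2
    then show ?thesis by (intro rot_commute_mixed[symmetric]) auto
  next
    case 3
    \<comment> \<open>This identity decides symmetrically whether the second translation wraps, and
      gives the remainder if it does not; \<open>swap\<close> gives the remainder if it
      does.\<close>
    have "(y \<rightharpoondown> c) \<rightharpoondown> x = (y \<rightharpoondown> c) \<rightharpoondown> ((x \<rightharpoondown> c) \<rightharpoondown> c)"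
      using 3 by (simp add: pimp_pimp_absorb)
    also have "\<dots> = (x \<rightharpoondown> c) \<rightharpoondown> ((y \<rightharpoondown> c) \<rightharpoondown> c)" by (rule swap) auto
    also have "\<dots> = (x \<rightharpoondown> c) \<rightharpoondown> y" using 3 by (simp add: pimp_pimp_absorb)
    finally have "(y \<rightharpoondown> c) \<rightharpoondown> x = (x \<rightharpoondown> c) \<rightharpoondown> y" .
    then show ?thesis using 3 swap[of x y c] by (simp add: rot_def le_iff_pimp[of "_ \<rightharpoondown> _"])
  next
    case 4
    then have le: "x \<preceq> c" "y \<preceq> c" using linear[of c x] linear[of c y] by auto
    let ?n = "\<lambda>u. u \<rightharpoondown> \<zero>"
    \<comment> \<open>Again the first identity settles the wrap condition and the unwrapped
      remainder; the second one, below, settles the wrapped remainder.\<close>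
    have "?n (c \<rightharpoondown> y) \<rightharpoondown> x = ?n x \<rightharpoondown> (c \<rightharpoondown> y)" by (simp add: neg_pimp_commute)
    also have "\<dots> = c \<rightharpoondown> (?n x \<rightharpoondown> y)" by (rule swap) auto
    also have "?n x \<rightharpoondown> y = ?n y \<rightharpoondown> x" by (simp add: neg_pimp_commute)
    also have "c \<rightharpoondown> (?n y \<rightharpoondown> x) = ?n y \<rightharpoondown> (c \<rightharpoondown> x)" by (rule swap) auto
    also have "\<dots> = ?n (c \<rightharpoondown> x) \<rightharpoondown> y" by (simp add: neg_pimp_commute)
    finally have nowrap: "?n (c \<rightharpoondown> y) \<rightharpoondown> x = ?n (c \<rightharpoondown> x) \<rightharpoondown> y" .
    have "x \<rightharpoondown> ?n (c \<rightharpoondown> y) = (c \<rightharpoondown> y) \<rightharpoondown> ?n x" by (rule swap) auto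
    also have "\<dots> = (c \<rightharpoondown> y) \<rightharpoondown> ((c \<rightharpoondown> x) \<rightharpoondown> ?n c)" by (simp add: pimp_pimp_pimp_zero le)
    also have "\<dots> = (c \<rightharpoondown> x) \<rightharpoondown> ((c \<rightharpoondown> y) \<rightharpoondown> ?n c)" by (rule swap) auto
    also have "\<dots> = (c \<rightharpoondown> x) \<rightharpoondown> ?n y" by (simp add: pimp_pimp_pimp_zero le)
    also have "\<dots> = y \<rightharpoondown> ?n (c \<rightharpoondown> x)" by (rule swap) auto
    finally have "x \<rightharpoondown> ?n (c \<rightharpoondown> y) = y \<rightharpoondown> ?n (c \<rightharpoondown> x)" .
    then show ?thesis using 4 nowrap by (simp add: rot_def le_iff_pimp[of "_ \<rightharpoondown> _"])
  qed
  then show ?thesis by (simp add: p)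
qed

text \<open>For \<open>y \<preceq> x\<close> the element \<open>x \<rightharpoondown> y\<close> is 1
  - x + y, so the two translations compose to the one by \<open>y\<close> and a full turn.\<close>

lemma rot_rot_pimp:
  assumes "y \<preceq> x" and [simp]: "x \<in> carrier A" "y \<in> carrier A" and "snd p \<in> carrier A"
  shows "rot (x \<rightharpoondown> y) (rot x p) = apfst ((+) 1) (rot y p)"
proof -
  obtain k c where p: "p = (k, c)" by (cases p)
  have [simp]: "c \<in> carrier A" using assms(4) p by simp
  have "rot (x \<rightharpoondown> y) (rot x (k, c)) = apfst ((+) 1) (rot y (k, c))"
  proof (cases "c \<preceq> x")
    case True
    have iff: "x \<rightharpoondown> c \<preceq> x \<rightharpoondown> y \<longleftrightarrow> c \<preceq> y"
    proof
      assume "x \<rightharpoondown> c \<preceq> x \<rightharpoondown> y"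
      then have "(x \<rightharpoondown> y) \<rightharpoondown> (x \<rightharpoondown> \<zero>) \<preceq> (x \<rightharpoondown> c) \<rightharpoondown> (x \<rightharpoondown> \<zero>)"
        by (rule pimp_anti) auto
      then show "c \<preceq> y" using assms(1) True by (simp add: pimp_pimp_pimp_zero le_neg_iff)
    qed (auto intro: pimp_mono)
    show ?thesis
    proof (cases "c \<preceq> y")
      case cy: True
      then show ?thesis using True iff by (simp add: rot_def pimp_chain[OF cy assms(1)])
    next
      case False
      then have "y \<preceq> c" using linear[of c y] by simp
      then show ?thesis using True False iff by (simp add: rot_def pimp_chain)
    qed
  next
    case False
    then have xc: "x \<preceq> c" and cy: "\<not> c \<preceq> y"
      using linear[of c x] le_trans[OF _ assms(1), of c] by auto
    have "(c \<rightharpoondown> x) \<rightharpoondown> \<zero> \<preceq> x \<rightharpoondown> \<zero>" by (rule pimp_anti) auto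
    also have "x \<rightharpoondown> \<zero> \<preceq> x \<rightharpoondown> y" by (rule pimp_mono) auto
    finally have "(c \<rightharpoondown> x) \<rightharpoondown> \<zero> \<preceq> x \<rightharpoondown> y" by simp
    moreover have "(x \<rightharpoondown> y) \<rightharpoondown> ((c \<rightharpoondown> x) \<rightharpoondown> \<zero>) = (c \<rightharpoondown> y) \<rightharpoondown> \<zero>"
      using pimp_neg_chain[OF assms(1) xc] swap[of "x \<rightharpoondown> y" "c \<rightharpoondown> x" \<zero>] by simp
    ultimately show ?thesis using False cy by (simp add: rot_def)
  qed
  then show ?thesis by (simp add: p)
qed

lemma rot_mono:
  assumes "rot_le p q" and [simp]: "x \<in> carrier A" "snd p \<in> carrier A" "snd q \<in> carrier A"
  shows "rot_le (rot x p) (rot x q)"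
proof (cases "fst p = fst q")
  case True
  then have le: "snd q \<preceq> snd p" using assms(1) by (simp add: rot_le_def)
  then have "snd q \<preceq> x" if "snd p \<preceq> x" using that by (rule le_trans) auto
  moreover have "(snd q \<rightharpoondown> x) \<rightharpoondown> \<zero> \<preceq> (snd p \<rightharpoondown> x) \<rightharpoondown> \<zero>"
    by (intro pimp_anti le) auto
  ultimately show ?thesis using True le by (auto simp: rot_le_def rot_def intro: pimp_mono)
next
  case False
  \<comment> \<open>If only \<open>p\<close> wraps, its integer part may catch up with that of
    \<open>q\<close>; then \<open>x \<rightharpoondown> \<zero>\<close> separates the
    remainders.\<close>
  have "(snd q \<rightharpoondown> x) \<rightharpoondown> \<zero> \<preceq> x \<rightharpoondown> \<zero>" by (rule pimp_anti) auto
  also have "x \<rightharpoondown> \<zero> \<preceq> x \<rightharpoondown> snd p" by (rule pimp_mono) auto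
  finally have "(snd q \<rightharpoondown> x) \<rightharpoondown> \<zero> \<preceq> x \<rightharpoondown> snd p" by simp
  then show ?thesis using False assms(1) by (auto simp: rot_le_def rot_def)
qed

lemma funpow_rot_mono:
  assumes "rot_le p q" "x \<in> carrier A" "snd p \<in> carrier A" "snd q \<in> carrier A"
  shows "rot_le ((rot x ^^ n) p) ((rot x ^^ n) q)"
  by (induction n) (use assms in \<open>auto intro: rot_mono\<close>)

text \<open>The base point codes -1 and is the \<open>rot_le\<close>-least pair with integer part 0;
  the first component counts wraps.\<close>

definition rot_count :: "nat \<Rightarrow> 'a \<Rightarrow> int" where
  "rot_count n x = fst ((rot x ^^ n) (0, \<one>))"

text \<open>\<open>p\<close> lies between the shifted base points \<open>(fst p, \<one>)\<close> and
  \<open>(fst p + 1, \<one>)\<close>, and iterated translations preserve the order and commute with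
  shifts.\<close>

lemma rot_count_bounds:
  assumes [simp]: "x \<in> carrier A" "snd p \<in> carrier A"
  shows "fst p + rot_count n x \<le> fst ((rot x ^^ n) p)"
    and "fst ((rot x ^^ n) p) \<le> fst p + rot_count n x + 1"
proof -
  have base: "fst ((rot x ^^ n) (j, \<one>)) = j + rot_count n x" for j
    using funpow_rot_shift[of n x j "(0, \<one>)"] by (simp add: rot_count_def)
  have "rot_le ((rot x ^^ n) (fst p, \<one>)) ((rot x ^^ n) p)"
    by (rule funpow_rot_mono) (auto simp: rot_le_def)
  then show "fst p + rot_count n x \<le> fst ((rot x ^^ n) p)"
    by (auto simp: rot_le_def base)
  have "rot_le ((rot x ^^ n) p) ((rot x ^^ n) (fst p + 1, \<one>))"
    by (rule funpow_rot_mono) (auto simp: rot_le_def)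
  then show "fst ((rot x ^^ n) p) \<le> fst p + rot_count n x + 1"
    by (auto simp: rot_le_def base)
qed

lemma rot_count_add:
  assumes "x \<in> carrier A"
  shows "rot_count m x + rot_count n x \<le> rot_count (m + n) x"
    and "rot_count (m + n) x \<le> rot_count m x + rot_count n x + 1"
  using rot_count_bounds[of x "(rot x ^^ n) (0, \<one>)" m] assms
  by (simp_all add: rot_count_def[of "m + n"] rot_count_def[of n] funpow_add)

lemma rot_count_mult:
  assumes "x \<in> carrier A"
  shows "int m * rot_count n x \<le> rot_count (m * n) x"
    and "rot_count (m * n) x \<le> int m * rot_count n x + int m"
proof (induction m)
  case (Suc m)
  {
    case 1
    then show ?case using Suc rot_count_add[OF assms, of n "m * n"] by (simp add: algebra_simps)
  next
    case 2
    then show ?case using Suc rot_count_add[OF assms, of n "m * n"] by (simp add: algebra_simps)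
  }
qed (simp_all add: rot_count_def)

lemma rot_count_range:
  assumes "x \<in> carrier A"
  shows "0 \<le> rot_count n x" "rot_count n x \<le> int n"
proof -
  have "0 \<le> rot_count n x \<and> rot_count n x \<le> int n"
    by (induction n) (auto simp: rot_count_def rot_def)
  then show "0 \<le> rot_count n x" "rot_count n x \<le> int n" by auto
qed

lemma rot_count_quotient_le: "x \<in> carrier A \<Longrightarrow> rot_count (Suc n) x / Suc n \<le> 1"
  using rot_count_range(2)[of x "Suc n"] by (simp del: of_nat_Suc)

text \<open>The counts are superadditive, so by Fekete's lemma this supremum is the limit of the
  averages. \<open>Suc n\<close> avoids division by zero.\<close>

definition rotation_number :: "'a \<Rightarrow> real" where
  "rotation_number x = (SUP n. rot_count (Suc n) x / Suc n)"

lemma rotation_number_bounds: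
  assumes x: "x \<in> carrier A"
  shows "rot_count n x \<le> n * rotation_number x"
    and "n * rotation_number x \<le> rot_count n x + 1"
proof -
  \<comment> \<open>Both averages are compared with the count after \<open>n * Suc k\<close>
    translations.\<close>
  have *: "rot_count (Suc k) x / Suc k \<le> (rot_count n x + 1) / n" if "n > 0" for k
  proof -
    have "int n * rot_count (Suc k) x \<le> int (Suc k) * rot_count n x + int (Suc k)"
      using rot_count_mult[OF x, of n "Suc k"] rot_count_mult[OF x, of "Suc k" n]
      by (simp add: mult.commute)
    then have "real_of_int (int n * rot_count (Suc k) x)
        \<le> real_of_int (int (Suc k) * rot_count n x + int (Suc k))"
      by (simp only: of_int_le_iff)
    then show ?thesis using that by (simp add: field_simps)
  qed
  have bdd: "bdd_above (range (\<lambda>n. rot_count (Suc n) x / Suc n))"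
    by (rule bdd_aboveI[of _ 1]) (use rot_count_quotient_le[OF x] in blast)
  show "rot_count n x \<le> n * rotation_number x"
  proof (cases n)
    case (Suc m)
    then show ?thesis
      using cSUP_upper[OF UNIV_I bdd, of m] by (simp add: rotation_number_def field_simps)
  qed (simp add: rot_count_def)
  show "n * rotation_number x \<le> rot_count n x + 1"
  proof (cases "n > 0")
    case True
    have "rotation_number x \<le> (rot_count n x + 1) / n"
      unfolding rotation_number_def by (rule cSUP_least) (use * True in auto)
    then show ?thesis using True by (simp add: field_simps)
  qed (simp add: rot_count_def)
qed

lemma rotation_number_range:
  assumes "x \<in> carrier A"
  shows "0 \<le> rotation_number x" "rotation_number x \<le> 1"
proof -
  show "0 \<le> rotation_number x"
    using rotation_number_bounds(1)[OF assms, of 1] rot_count_range(1)[OF assms, of 1] by simp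
  show "rotation_number x \<le> 1"
    unfolding rotation_number_def
    by (rule cSUP_least) (use rot_count_quotient_le[OF assms] in auto)
qed

lemma funpow_rot_commute:
  assumes "x \<in> carrier A" "y \<in> carrier A" "snd p \<in> carrier A"
  shows "(rot x ^^ n) (rot y p) = rot y ((rot x ^^ n) p)"
  by (induction n) (use assms in \<open>auto simp: rot_commute\<close>)

lemma funpow_rot_rot_pimp:
  assumes "y \<preceq> x" and [simp]: "x \<in> carrier A" "y \<in> carrier A" "snd p \<in> carrier A"
  shows "(rot (x \<rightharpoondown> y) ^^ n) ((rot x ^^ n) p) = apfst ((+) (int n)) ((rot y ^^ n) p)"
proof (induction n)
  case (Suc n)
  have "(rot (x \<rightharpoondown> y) ^^ Suc n) ((rot x ^^ Suc n) p)
      = rot (x \<rightharpoondown> y) (rot x ((rot (x \<rightharpoondown> y) ^^ n) ((rot x ^^ n) p)))"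
    by (simp add: funpow_rot_commute)
  also have "\<dots> = apfst ((+) (int (Suc n))) ((rot y ^^ Suc n) p)"
    by (subst rot_rot_pimp) (auto simp: assms(1) Suc rot_shift prod_eq_iff)
  finally show ?case .
qed (simp add: prod_eq_iff)

lemma rotation_number_pimp:
  assumes "y \<preceq> x" and [simp]: "x \<in> carrier A" "y \<in> carrier A"
  shows "rotation_number (x \<rightharpoondown> y) = 1 + rotation_number y - rotation_number x"
proof (rule ccontr)
  \<comment> \<open>\<open>d\<close> is the defect of the claim. The counts satisfy the
    corresponding equation up to 1 and each is within 1 of \<open>n\<close> times its rotation
    number, so \<open>n * \<bar>d\<bar>\<close> stays at most 3 for every \<open>n\<close>.\<close>
  define d where "d = rotation_number x + rotation_number (x \<rightharpoondown> y) - 1 - rotation_number y"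
  assume "\<not> ?thesis"
  then have "\<bar>d\<bar> > 0" by (auto simp: d_def)
  then obtain n where n: "3 < of_nat n * \<bar>d\<bar>" using reals_Archimedean3 by blast
  have "rot_count n x + rot_count n (x \<rightharpoondown> y) \<le> n + rot_count n y"
    "n + rot_count n y \<le> rot_count n x + rot_count n (x \<rightharpoondown> y) + 1"
    using rot_count_bounds[of "x \<rightharpoondown> y" "(rot x ^^ n) (0, \<one>)" n]
      funpow_rot_rot_pimp[OF assms(1), of "(0, \<one>)" n]
    by (simp_all add: rot_count_def[of n x] rot_count_def[of n y])
  then have "real_of_int (rot_count n x) + rot_count n (x \<rightharpoondown> y) \<le> n + rot_count n y"
    "n + rot_count n y \<le> real_of_int (rot_count n x) + rot_count n (x \<rightharpoondown> y) + 1"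
    by linarith+
  then have "\<bar>n * rotation_number x + n * rotation_number (x \<rightharpoondown> y) - n - n * rotation_number y\<bar> \<le> 3"
    using rotation_number_bounds[of x n] rotation_number_bounds[of y n]
      rotation_number_bounds[of "x \<rightharpoondown> y" n] by (simp add: abs_le_iff)
  then have "\<bar>real n * d\<bar> \<le> 3" by (simp add: d_def algebra_simps)
  then show False using n by (simp add: abs_mult)
qed

lemma bosbach_state_rotation_number: "bosbach_state A rotation_number"
proof -
  \<comment> \<open>Nontriviality prevents a wrap here, since
    \<open>\<one> \<preceq> \<zero>\<close> fails.\<close>
  have "(rot \<zero> ^^ n) (0, \<one>) = (0, \<one>)" for n
    by (induction n) (use nontrivial in \<open>auto simp: rot_def\<close>)
  then have zero: "rotation_number \<zero> = 0" by (simp add: rotation_number_def rot_count_def del: funpow.simps)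
  have "(rot \<one> ^^ n) (0, \<one>) = (int n, \<one>)" for n
    by (induction n) (auto simp: rot_def)
  then have one: "rotation_number \<one> = 1"
    by (simp add: rotation_number_def rot_count_def del: funpow.simps)
  have "rotation_number x + rotation_number (x \<rightharpoondown> y) = rotation_number y + rotation_number (y \<rightharpoondown> x)"
    if "x \<in> carrier A" "y \<in> carrier A" for x y
    using linear[OF that]
  proof
    assume "x \<preceq> y"
    then show ?thesis using that le_iff_pimp[of x y] by (simp add: one rotation_number_pimp)
  next
    assume "y \<preceq> x"
    then show ?thesis using that le_iff_pimp[of y x] by (simp add: one rotation_number_pimp)
  qed
  then show ?thesis
    by (auto simp: bosbach_state_def zero one rotation_number_range wimp_eq_pimp)
qed

end

section \<open>Nilpotence, linearity and the translation to MV-algebras\<close>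

text \<open>This is the filter generated by \<open>u\<close>. Sliding the iterates past
  \<open>a \<rightharpoondown>\<close> turns the second premise of modus ponens into
  \<open>a \<preceq> ((\<rightharpoondown>) u ^^ m) b\<close>, to which \<open>n\<close> more
  implications apply.\<close>

lemma (in wajsberg) pbck_filter_funpow_pimp:
  assumes [simp]: "u \<in> carrier A"
  shows "pbck_filter A {x \<in> carrier A. \<exists>n. ((\<rightharpoondown>) u ^^ n) x = \<one>}"
proof -
  have "\<exists>k. ((\<rightharpoondown>) u ^^ k) b = \<one>"
    if n: "((\<rightharpoondown>) u ^^ n) a = \<one>" and m: "((\<rightharpoondown>) u ^^ m) (a \<rightharpoondown> b) = \<one>"
      and [simp]: "a \<in> carrier A" "b \<in> carrier A" for a b m n
  proof -
    have "a \<preceq> ((\<rightharpoondown>) u ^^ m) b"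
      using m funpow_pimp_wimp[of u a b m] by (simp add: wimp_eq_pimp le_iff_pimp)
    then have "((\<rightharpoondown>) u ^^ n) a \<preceq> ((\<rightharpoondown>) u ^^ n) (((\<rightharpoondown>) u ^^ m) b)"
      by (rule funpow_pimp_mono) auto
    then have "((\<rightharpoondown>) u ^^ (n + m)) b = \<one>" using n by (simp add: funpow_add)
    then show ?thesis ..
  qed
  moreover have "((\<rightharpoondown>) u ^^ 0) \<one> = \<one>" by simp
  ultimately show ?thesis unfolding pbck_filter_def by blast
qed

text \<open>By prelinearity \<open>y \<rightharpoondown> x\<close> is fixed under implication by
  \<open>x \<rightharpoondown> y\<close>. If the latter is not \<open>\<one>\<close>, some iterate
  sends \<open>\<zero>\<close>, and hence everything above it, to \<open>\<one>\<close>.\<close>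

lemma (in wajsberg) linear_wajsberg_if_nilpotent:
  assumes "\<And>u. \<lbrakk>u \<in> carrier A; u \<noteq> \<one>\<rbrakk> \<Longrightarrow> \<exists>n. ((\<rightharpoondown>) u ^^ n) \<zero> = \<one>" and "\<zero> \<noteq> \<one>"
  shows "linear_wajsberg A"
proof
  fix x y assume [simp]: "x \<in> carrier A" "y \<in> carrier A"
  show "x \<preceq> y \<or> y \<preceq> x"
  proof (cases "x \<rightharpoondown> y = \<one>")
    case False
    then obtain n where n: "((\<rightharpoondown>) (x \<rightharpoondown> y) ^^ n) \<zero> = \<one>"
      using assms(1)[of "x \<rightharpoondown> y"] by auto
    have "((\<rightharpoondown>) (x \<rightharpoondown> y) ^^ k) (y \<rightharpoondown> x) = y \<rightharpoondown> x" for k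
      by (induction k) (simp_all add: prelinear)
    moreover have "((\<rightharpoondown>) (x \<rightharpoondown> y) ^^ n) \<zero> \<preceq> ((\<rightharpoondown>) (x \<rightharpoondown> y) ^^ n) (y \<rightharpoondown> x)"
      by (rule funpow_pimp_mono) auto
    ultimately have "y \<rightharpoondown> x = \<one>" unfolding n by simp
    then show ?thesis by (simp add: le_iff_pimp[of y x])
  next
    case True
    then show ?thesis by (simp add: le_iff_pimp[of x y])
  qed
qed (fact assms(2))

text \<open>Replaces the existence of an MV-algebra by two equations, which are easy to pass between
  quotients. The Lukasiewicz axiom becomes \<open>pimp_pimp_commute\<close>.\<close>

lemma (in bounded_pseudo_BCK) termwise_equiv_MV_iff_wajsberg:
  "termwise_equiv_MV A \<longleftrightarrow> wajsberg A"
proof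
  assume "termwise_equiv_MV A"
  then obtain M :: "'a mv" where M: "MV_algebra M" and same: "same_pbck A (pbck_of_mv M)"
    by (auto simp: termwise_equiv_MV_def)
  interpret MV_algebra M by (fact M)
  have car: "carrier M = carrier A"
    and ops: "\<And>x y. \<lbrakk>x \<in> carrier A; y \<in> carrier A\<rbrakk> \<Longrightarrow> x \<rightharpoondown> y = mv_neg M x \<oplus>\<^bsub>M\<^esub> y"
      "\<And>x y. \<lbrakk>x \<in> carrier A; y \<in> carrier A\<rbrakk> \<Longrightarrow> x \<leadsto> y = mv_neg M x \<oplus>\<^bsub>M\<^esub> y"
    using same by (auto simp: same_pbck_def pbck_of_mv_def)
  show "wajsberg A"
  proof
    fix x y assume xy: "x \<in> carrier A" "y \<in> carrier A"
    then show "x \<leadsto> y = x \<rightharpoondown> y" by (simp add: ops)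
    show "(x \<rightharpoondown> y) \<rightharpoondown> y = (y \<rightharpoondown> x) \<rightharpoondown> x"
      using lukasiewicz[of x y] xy add_closed neg_closed by (simp add: ops car)
  qed
next
  assume "wajsberg A"
  then interpret wajsberg A .
  define M :: "'a mv" where
    "M = \<lparr>carrier = carrier A, mv_add = \<lambda>x y. (x \<rightharpoondown> \<zero>) \<rightharpoondown> y, mv_neg = \<lambda>x. x \<rightharpoondown> \<zero>,
      mv_zero = \<zero>, mv_one = \<one>\<rparr>"
  have "MV_algebra M"
  proof
    fix x y z assume "x \<in> carrier M" "y \<in> carrier M" "z \<in> carrier M"
    then have [simp]: "x \<in> carrier A" "y \<in> carrier A" "z \<in> carrier A" by (auto simp: M_def)
    have "(((x \<rightharpoondown> \<zero>) \<rightharpoondown> y) \<rightharpoondown> \<zero>) \<rightharpoondown> z = (z \<rightharpoondown> \<zero>) \<rightharpoondown> ((x \<rightharpoondown> \<zero>) \<rightharpoondown> y)"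
      by (rule neg_pimp_commute) auto
    also have "\<dots> = (x \<rightharpoondown> \<zero>) \<rightharpoondown> ((z \<rightharpoondown> \<zero>) \<rightharpoondown> y)"
      by (rule swap) auto
    also have "(z \<rightharpoondown> \<zero>) \<rightharpoondown> y = (y \<rightharpoondown> \<zero>) \<rightharpoondown> z"
      by (rule neg_pimp_commute) auto
    finally show "(x \<oplus>\<^bsub>M\<^esub> y) \<oplus>\<^bsub>M\<^esub> z = x \<oplus>\<^bsub>M\<^esub> (y \<oplus>\<^bsub>M\<^esub> z)"
      by (simp add: M_def)
  next
    fix x y assume "x \<in> carrier M" "y \<in> carrier M"
    then have [simp]: "x \<in> carrier A" "y \<in> carrier A" by (auto simp: M_def)
    show "x \<oplus>\<^bsub>M\<^esub> y = y \<oplus>\<^bsub>M\<^esub> x"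
      using neg_pimp_commute[of x y] by (simp add: M_def)
    show "mv_neg M (mv_neg M x \<oplus>\<^bsub>M\<^esub> y) \<oplus>\<^bsub>M\<^esub> y = mv_neg M (mv_neg M y \<oplus>\<^bsub>M\<^esub> x) \<oplus>\<^bsub>M\<^esub> x"
      using pimp_pimp_commute[of x y] by (simp add: M_def)
  qed (simp_all add: M_def)
  moreover have "same_pbck A (pbck_of_mv M)"
    by (simp add: same_pbck_def pbck_of_mv_def M_def le_iff_pimp wimp_eq_pimp)
  ultimately show "termwise_equiv_MV A" by (auto simp: termwise_equiv_MV_def)
qed

section \<open>Filters and quotients by normal filters\<close>

lemma pbck_filter_mp:
  "\<lbrakk>pbck_filter A F; a \<in> F; a \<rightharpoondown>\<^bsub>A\<^esub> b \<in> F; b \<in> carrier A\<rbrakk> \<Longrightarrow> b \<in> F"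
  unfolding pbck_filter_def by blast

text \<open>Turns properness into the exclusion of one element, a condition that survives unions of
  chains.\<close>

lemma (in bounded_pseudo_BCK) pbck_filter_eq_carrier_iff:
  assumes F: "pbck_filter A F"
  shows "F = carrier A \<longleftrightarrow> \<zero> \<in> F"
proof
  assume "\<zero> \<in> F"
  have "x \<in> F" if "x \<in> carrier A" for x
  proof -
    have "\<zero> \<rightharpoondown> x \<in> F" using F that by (simp add: pbck_filter_def)
    then show ?thesis by (rule pbck_filter_mp[OF F \<open>\<zero> \<in> F\<close>]) (fact that)
  qed
  then show "F = carrier A" using F by (auto simp: pbck_filter_def)
qed auto

locale normal_quotient = bounded_pseudo_BCK +
  fixes F :: "'a set"
  assumes normal: "normal_filter A F"
begin

abbreviation Q :: "'a set bounded_pseudo_bck" where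
  "Q \<equiv> quotient_pbck A F"

definition cls :: "'a \<Rightarrow> 'a set" where
  "cls a = filter_rel A F `` {a}"

lemma filter: "pbck_filter A F"
  using normal by (simp add: normal_filter_def)

lemma one_mem [simp]: "\<one> \<in> F"
  using filter by (simp add: pbck_filter_def)

lemma mem_carrier: "a \<in> F \<Longrightarrow> a \<in> carrier A"
  using filter by (auto simp: pbck_filter_def)

lemma filter_mp: "\<lbrakk>a \<in> F; a \<rightharpoondown> b \<in> F; b \<in> carrier A\<rbrakk> \<Longrightarrow> b \<in> F"
  by (rule pbck_filter_mp[OF filter])

lemma wimp_mem_iff: "\<lbrakk>a \<in> carrier A; b \<in> carrier A\<rbrakk> \<Longrightarrow> a \<leadsto> b \<in> F \<longleftrightarrow> a \<rightharpoondown> b \<in> F"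
  using normal by (simp add: normal_filter_def)

lemma mem_mono: "\<lbrakk>a \<in> F; a \<preceq> b; b \<in> carrier A\<rbrakk> \<Longrightarrow> b \<in> F"
  using filter_mp[of a b] mem_carrier[of a] le_iff_pimp[of a b] by simp

lemma pimp_mem_anti:
  assumes "x \<rightharpoondown> y \<in> F" and [simp]: "x \<in> carrier A" "y \<in> carrier A" "z \<in> carrier A"
  shows "(y \<rightharpoondown> z) \<rightharpoondown> (x \<rightharpoondown> z) \<in> F"
  using mem_mono[OF assms(1) pimp_trans[of x y z]] by (simp add: wimp_mem_iff)

lemma wimp_mem_anti:
  assumes "x \<rightharpoondown> y \<in> F" and [simp]: "x \<in> carrier A" "y \<in> carrier A" "z \<in> carrier A"
  shows "(y \<leadsto> z) \<rightharpoondown> (x \<leadsto> z) \<in> F"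
  using mem_mono[OF _ wimp_trans[of x y z]] assms(1) by (simp add: wimp_mem_iff)

lemma pimp_mem_mono:
  assumes "x \<rightharpoondown> y \<in> F" and [simp]: "x \<in> carrier A" "y \<in> carrier A" "z \<in> carrier A"
  shows "(z \<rightharpoondown> x) \<rightharpoondown> (z \<rightharpoondown> y) \<in> F"
  using mem_mono[OF assms(1) pimp_pimp_mono[of x y z]] by simp

lemma wimp_mem_mono:
  assumes "x \<rightharpoondown> y \<in> F" and [simp]: "x \<in> carrier A" "y \<in> carrier A" "z \<in> carrier A"
  shows "(z \<leadsto> x) \<rightharpoondown> (z \<leadsto> y) \<in> F"
  using mem_mono[OF _ wimp_wimp_mono[of x y z]] assms(1) by (simp add: wimp_mem_iff)

lemma pimp_mem_trans:
  assumes "x \<rightharpoondown> y \<in> F" "y \<rightharpoondown> z \<in> F"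
    and "x \<in> carrier A" "y \<in> carrier A" "z \<in> carrier A"
  shows "x \<rightharpoondown> z \<in> F"
  using filter_mp[OF assms(2) pimp_mem_anti[OF assms(1)]] assms by simp

lemma equiv_filter_rel: "equiv (carrier A) (filter_rel A F)"
proof (rule equivI)
  show "trans (filter_rel A F)"
    by (rule transI) (simp add: filter_rel_def, metis pimp_mem_trans)
qed (auto simp: filter_rel_def refl_on_def sym_def)

lemma mem_cls_iff: "x \<in> cls a \<longleftrightarrow> x \<in> carrier A \<and> a \<in> carrier A \<and> a \<rightharpoondown> x \<in> F \<and> x \<rightharpoondown> a \<in> F"
  by (auto simp: cls_def filter_rel_def)

lemma cls_eq_iff:
  "\<lbrakk>a \<in> carrier A; b \<in> carrier A\<rbrakk> \<Longrightarrow> cls a = cls b \<longleftrightarrow> a \<rightharpoondown> b \<in> F \<and> b \<rightharpoondown> a \<in> F"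
  using eq_equiv_class_iff[OF equiv_filter_rel, of a b] by (simp add: cls_def filter_rel_def)

lemma self_mem_cls: "a \<in> carrier A \<Longrightarrow> a \<in> cls a"
  by (simp add: mem_cls_iff)

lemma cls_nonempty [simp]: "a \<in> carrier A \<Longrightarrow> cls a \<noteq> {}"
  using self_mem_cls by blast

lemma carrier_Q: "carrier Q = cls ` carrier A"
  by (auto simp: quotient_pbck_def quotient_def cls_def)

lemma one_Q: "\<one>\<^bsub>Q\<^esub> = cls \<one>" and zero_Q: "\<zero>\<^bsub>Q\<^esub> = cls \<zero>"
  by (auto simp: quotient_pbck_def cls_def)

lemma pimp_cls:
  assumes [simp]: "a \<in> carrier A" "b \<in> carrier A"
  shows "cls a \<rightharpoondown>\<^bsub>Q\<^esub> cls b = cls (a \<rightharpoondown> b)"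
proof -
  have "cls (a' \<rightharpoondown> b') = cls (a \<rightharpoondown> b)" if "a' \<in> cls a" "b' \<in> cls b" for a' b'
  proof -
    have [simp]: "a' \<in> carrier A" "b' \<in> carrier A" using that by (auto simp: mem_cls_iff)
    have "cls (a' \<rightharpoondown> b') = cls (a \<rightharpoondown> b')"
      using that(1) by (simp add: cls_eq_iff mem_cls_iff pimp_mem_anti)
    also have "\<dots> = cls (a \<rightharpoondown> b)"
      using that(2) by (simp add: cls_eq_iff mem_cls_iff pimp_mem_mono)
    finally show ?thesis .
  qed
  then have "(\<Union>a'\<in>cls a. \<Union>b'\<in>cls b. cls (a' \<rightharpoondown> b'))
      = (\<Union>a'\<in>cls a. \<Union>b'\<in>cls b. cls (a \<rightharpoondown> b))"
    by (intro SUP_cong refl)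
  also have "\<dots> = cls (a \<rightharpoondown> b)"
    by simp
  finally have "(\<Union>a'\<in>cls a. \<Union>b'\<in>cls b. cls (a' \<rightharpoondown> b')) = cls (a \<rightharpoondown> b)" .
  then show ?thesis
    by (simp add: quotient_pbck_def cls_def)
qed

lemma wimp_cls:
  assumes [simp]: "a \<in> carrier A" "b \<in> carrier A"
  shows "cls a \<leadsto>\<^bsub>Q\<^esub> cls b = cls (a \<leadsto> b)"
proof -
  have "cls (a' \<leadsto> b') = cls (a \<leadsto> b)" if "a' \<in> cls a" "b' \<in> cls b" for a' b'
  proof -
    have [simp]: "a' \<in> carrier A" "b' \<in> carrier A" using that by (auto simp: mem_cls_iff)
    have "cls (a' \<leadsto> b') = cls (a \<leadsto> b')"
      using that(1) by (simp add: cls_eq_iff mem_cls_iff wimp_mem_anti)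
    also have "\<dots> = cls (a \<leadsto> b)"
      using that(2) by (simp add: cls_eq_iff mem_cls_iff wimp_mem_mono)
    finally show ?thesis .
  qed
  then have "(\<Union>a'\<in>cls a. \<Union>b'\<in>cls b. cls (a' \<leadsto> b'))
      = (\<Union>a'\<in>cls a. \<Union>b'\<in>cls b. cls (a \<leadsto> b))"
    by (intro SUP_cong refl)
  also have "\<dots> = cls (a \<leadsto> b)"
    by simp
  finally have "(\<Union>a'\<in>cls a. \<Union>b'\<in>cls b. cls (a' \<leadsto> b')) = cls (a \<leadsto> b)" .
  then show ?thesis
    by (simp add: quotient_pbck_def cls_def)
qed

lemma le_cls_iff:
  assumes [simp]: "a \<in> carrier A" "b \<in> carrier A"
  shows "cls a \<preceq>\<^bsub>Q\<^esub> cls b \<longleftrightarrow> a \<rightharpoondown> b \<in> F"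
proof
  assume "cls a \<preceq>\<^bsub>Q\<^esub> cls b"
  then obtain a' b' where "a' \<in> cls a" "b' \<in> cls b" "a' \<rightharpoondown> b' \<in> F"
    by (auto simp: quotient_pbck_def)
  then show "a \<rightharpoondown> b \<in> F"
    using pimp_mem_trans[of a a' b'] pimp_mem_trans[of a b' b] by (simp add: mem_cls_iff)
next
  assume "a \<rightharpoondown> b \<in> F"
  then show "cls a \<preceq>\<^bsub>Q\<^esub> cls b"
    using self_mem_cls[of a] self_mem_cls[of b] by (auto simp: quotient_pbck_def)
qed

lemma cls_eq_one_iff:
  assumes [simp]: "a \<in> carrier A"
  shows "cls a = cls \<one> \<longleftrightarrow> a \<in> F"
  by (simp add: cls_eq_iff)

lemma le_mem: "\<lbrakk>a \<preceq> b; a \<in> carrier A; b \<in> carrier A\<rbrakk> \<Longrightarrow> a \<rightharpoondown> b \<in> F"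
  by (simp add: le_iff_pimp)

lemma bounded_pseudo_BCK_Q: "bounded_pseudo_BCK Q"
proof (unfold_locales, unfold carrier_Q one_Q zero_Q)
  note [simp] = pimp_cls wimp_cls le_cls_iff
  fix x y z
  assume xyz: "x \<in> cls ` carrier A" "y \<in> cls ` carrier A" "z \<in> cls ` carrier A"
  show "x \<rightharpoondown>\<^bsub>Q\<^esub> y \<preceq>\<^bsub>Q\<^esub> (y \<rightharpoondown>\<^bsub>Q\<^esub> z) \<leadsto>\<^bsub>Q\<^esub> (x \<rightharpoondown>\<^bsub>Q\<^esub> z)"
    using xyz by (auto intro!: le_mem pimp_trans)
  show "x \<leadsto>\<^bsub>Q\<^esub> y \<preceq>\<^bsub>Q\<^esub> (y \<leadsto>\<^bsub>Q\<^esub> z) \<rightharpoondown>\<^bsub>Q\<^esub> (x \<leadsto>\<^bsub>Q\<^esub> z)"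
    using xyz by (auto intro!: le_mem wimp_trans)
next
  note [simp] = pimp_cls wimp_cls le_cls_iff
  fix x y
  assume xy: "x \<in> cls ` carrier A" "y \<in> cls ` carrier A"
  show "x \<rightharpoondown>\<^bsub>Q\<^esub> y \<in> cls ` carrier A" "x \<leadsto>\<^bsub>Q\<^esub> y \<in> cls ` carrier A"
    using xy by auto
  show "x \<preceq>\<^bsub>Q\<^esub> (x \<rightharpoondown>\<^bsub>Q\<^esub> y) \<leadsto>\<^bsub>Q\<^esub> y"
    using xy by (auto intro!: le_mem pimp_mp)
  show "x \<preceq>\<^bsub>Q\<^esub> (x \<leadsto>\<^bsub>Q\<^esub> y) \<rightharpoondown>\<^bsub>Q\<^esub> y"
    using xy by (auto intro!: le_mem wimp_mp)
  show "x \<preceq>\<^bsub>Q\<^esub> y \<longleftrightarrow> x \<rightharpoondown>\<^bsub>Q\<^esub> y = cls \<one>"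
    using xy by (elim imageE) (simp add: cls_eq_one_iff)
  show "x \<preceq>\<^bsub>Q\<^esub> y \<longleftrightarrow> x \<leadsto>\<^bsub>Q\<^esub> y = cls \<one>"
    using xy by (elim imageE) (simp add: cls_eq_one_iff wimp_mem_iff)
  show "x = y" if "x \<preceq>\<^bsub>Q\<^esub> y" "y \<preceq>\<^bsub>Q\<^esub> x"
    using xy that by (elim imageE) (simp add: cls_eq_iff)
next
  fix x
  assume x: "x \<in> cls ` carrier A"
  then show "x \<preceq>\<^bsub>Q\<^esub> x" "x \<preceq>\<^bsub>Q\<^esub> cls \<one>" "cls \<zero> \<preceq>\<^bsub>Q\<^esub> x"
    by (auto simp: le_cls_iff)
qed auto

lemma wajsberg_Q_iff:
  "wajsberg Q \<longleftrightarrow> (\<forall>a\<in>carrier A. \<forall>b\<in>carrier A.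
    cls (a \<leadsto> b) = cls (a \<rightharpoondown> b) \<and> cls ((a \<rightharpoondown> b) \<rightharpoondown> b) = cls ((b \<rightharpoondown> a) \<rightharpoondown> a))"
proof -
  have "wajsberg Q \<longleftrightarrow> (\<forall>x\<in>carrier Q. \<forall>y\<in>carrier Q.
    x \<leadsto>\<^bsub>Q\<^esub> y = x \<rightharpoondown>\<^bsub>Q\<^esub> y \<and> (x \<rightharpoondown>\<^bsub>Q\<^esub> y) \<rightharpoondown>\<^bsub>Q\<^esub> y = (y \<rightharpoondown>\<^bsub>Q\<^esub> x) \<rightharpoondown>\<^bsub>Q\<^esub> x)"
    unfolding wajsberg_def wajsberg_axioms_def using bounded_pseudo_BCK_Q by blast
  then show ?thesis by (simp add: carrier_Q pimp_cls wimp_cls)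
qed

lemma termwise_equiv_MV_Q_iff: "termwise_equiv_MV Q \<longleftrightarrow> wajsberg Q"
  using bounded_pseudo_BCK.termwise_equiv_MV_iff_wajsberg[OF bounded_pseudo_BCK_Q] .

end

section \<open>The quotient by the kernel of a state\<close>

lemma (in bosbach) wajsberg_quotient_kernel: "wajsberg (quotient_pbck A kernel)"
proof -
  interpret K: normal_quotient A kernel
    by unfold_locales (rule normal_filter_kernel)
  \<comment> \<open>The chosen representative does not matter: for equivalent \<open>a\<close> and
    \<open>b\<close> both implications have state 1, so Bosbach's identity gives
    \<open>s a = s b\<close>.\<close>
  define t where "t X = s (SOME a. a \<in> X)" for X
  have t: "t (K.cls a) = s a" if "a \<in> carrier A" for a
  proof -
    define b where "b = (SOME b. b \<in> K.cls a)"
    have "b \<in> K.cls a" unfolding b_def using K.self_mem_cls[OF that] by (rule someI)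
    then have "b \<in> carrier A" "s (a \<rightharpoondown> b) = 1" "s (b \<rightharpoondown> a) = 1"
      by (simp_all add: K.mem_cls_iff) (simp_all add: kernel_def)
    then show ?thesis using state_pimp[of a b] that by (simp add: t_def flip: b_def)
  qed
  interpret Q: bounded_pseudo_BCK K.Q by (rule K.bounded_pseudo_BCK_Q)
  have "bosbach_state K.Q t"
    by (auto simp: bosbach_state_def K.carrier_Q K.one_Q K.zero_Q K.pimp_cls K.wimp_cls t
        state_nonneg state_le_1 state_pimp state_wimp)
  then interpret Q: faithful_bosbach K.Q t
  proof unfold_locales
    fix X assume X: "X \<in> carrier K.Q" "t X = 1"
    then obtain a where a: "a \<in> carrier A" "X = K.cls a" by (auto simp: K.carrier_Q)
    then have "a \<in> kernel" using X(2) t by (simp add: kernel_def)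
    then show "X = \<one>\<^bsub>K.Q\<^esub>" using a by (simp add: K.one_Q K.cls_eq_one_iff)
  qed
  show ?thesis
  proof
    fix x y assume xy: "x \<in> carrier K.Q" "y \<in> carrier K.Q"
    show "x \<leadsto>\<^bsub>K.Q\<^esub> y = x \<rightharpoondown>\<^bsub>K.Q\<^esub> y" using Q.pimp_eq_wimp[OF xy] by simp
    show "(x \<rightharpoondown>\<^bsub>K.Q\<^esub> y) \<rightharpoondown>\<^bsub>K.Q\<^esub> y = (y \<rightharpoondown>\<^bsub>K.Q\<^esub> x) \<rightharpoondown>\<^bsub>K.Q\<^esub> x"
      using Q.join_commute[OF xy] xy by (simp add: Q.join_def Q.pimp_eq_wimp)
  qed
qed

section \<open>Enlarging filters, maximality and linearity\<close>

lemma (in bounded_pseudo_BCK) maximal_filter_extends: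
  assumes "pbck_filter A F" "F \<noteq> carrier A"
  obtains G where "maximal_filter A G" "F \<subseteq> G"
proof -
  define S where "S = {G. pbck_filter A G \<and> F \<subseteq> G \<and> \<zero> \<notin> G}"
  have "\<exists>M\<in>S. \<forall>X\<in>S. M \<subseteq> X \<longrightarrow> X = M"
  proof (rule subset_Zorn_nonempty)
    have "F \<in> S" using assms pbck_filter_eq_carrier_iff[of F] by (simp add: S_def)
    then show "S \<noteq> {}" by (rule ex_in_conv[THEN iffD1, OF exI])
    fix C assume C: "C \<noteq> {}" "subset.chain S C"
    have "C \<subseteq> S" and total: "\<And>G H. \<lbrakk>G \<in> C; H \<in> C\<rbrakk> \<Longrightarrow> G \<subseteq> H \<or> H \<subseteq> G"
      using C(2) unfolding subset_chain_def by blast+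
    then have mem: "pbck_filter A G" "F \<subseteq> G" "\<zero> \<notin> G" if "G \<in> C" for G
      using that unfolding S_def by blast+
    have closed: "b \<in> \<Union>C" if ab: "a \<in> carrier A" "b \<in> carrier A" "a \<in> \<Union>C" "a \<rightharpoondown> b \<in> \<Union>C" for a b
    proof -
      obtain G H where GH: "G \<in> C" "a \<in> G" "H \<in> C" "a \<rightharpoondown> b \<in> H"
        using ab(3,4) by (elim UnionE)
      then have "G \<subseteq> H \<or> H \<subseteq> G" by (intro total)
      then have "\<exists>K\<in>C. a \<in> K \<and> a \<rightharpoondown> b \<in> K" using GH by (meson subsetD)
      then obtain K where K: "K \<in> C" "a \<in> K" "a \<rightharpoondown> b \<in> K" by auto
      then have "b \<in> K" using pbck_filter_mp[OF mem(1)] ab(2) by blast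
      then show ?thesis using K(1) by (rule UnionI[rotated])
    qed
    have "G \<subseteq> carrier A" "\<one> \<in> G" if "G \<in> C" for G
      using mem(1)[OF that] unfolding pbck_filter_def by blast+
    then have "\<Union>C \<subseteq> carrier A" "\<one> \<in> \<Union>C" using C(1) by blast+
    then have "pbck_filter A (\<Union>C)"
      unfolding pbck_filter_def by (intro conjI ballI impI) (auto intro: closed simp del: Union_iff)
    moreover have "F \<subseteq> \<Union>C" using C(1) mem(2) by fast
    moreover have "\<zero> \<notin> \<Union>C" using mem(3) by (auto simp only: Union_iff)
    ultimately show "\<Union>C \<in> S" by (simp add: S_def)
  qed
  then obtain M where M: "M \<in> S" "\<forall>X\<in>S. M \<subseteq> X \<longrightarrow> X = M" ..
  have "maximal_filter A M"
    unfolding maximal_filter_def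
  proof (intro conjI notI)
    show "pbck_filter A M" using M(1) by (simp add: S_def)
    show False if "M = carrier A" using M(1) that by (simp add: S_def)
    assume "\<exists>G. pbck_filter A G \<and> G \<noteq> carrier A \<and> M \<subset> G"
    then obtain G where G: "pbck_filter A G" "G \<noteq> carrier A" "M \<subset> G" by (elim exE conjE)
    then have "G \<in> S" using M(1) pbck_filter_eq_carrier_iff[of G] by (auto simp: S_def)
    with G(3) M(2) show False by (auto simp: psubset_eq)
  qed
  moreover have "F \<subseteq> M" using M(1) by (simp add: S_def)
  ultimately show thesis by (rule that)
qed

context normal_quotient
begin

text \<open>The two implications agree modulo \<open>F\<close>, so each implies the other by an
  element of \<open>G\<close>.\<close>

lemma normal_filter_extends:
  assumes "wajsberg Q" and G: "pbck_filter A G" "F \<subseteq> G"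
  shows "normal_filter A G"
proof -
  have "a \<rightharpoondown> b \<in> G \<longleftrightarrow> a \<leadsto> b \<in> G" if [simp]: "a \<in> carrier A" "b \<in> carrier A" for a b
  proof -
    have "cls (a \<leadsto> b) = cls (a \<rightharpoondown> b)" using assms(1) that unfolding wajsberg_Q_iff by blast
    then have *: "(a \<rightharpoondown> b) \<rightharpoondown> (a \<leadsto> b) \<in> G" "(a \<leadsto> b) \<rightharpoondown> (a \<rightharpoondown> b) \<in> G"
      using G(2) cls_eq_iff[of "a \<leadsto> b" "a \<rightharpoondown> b"] by auto
    show ?thesis
    proof
      assume "a \<rightharpoondown> b \<in> G"
      then show "a \<leadsto> b \<in> G" using *(1) by (rule pbck_filter_mp[OF G(1)]) auto
    next
      assume "a \<leadsto> b \<in> G"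
      then show "a \<rightharpoondown> b \<in> G" using *(2) by (rule pbck_filter_mp[OF G(1)]) auto
    qed
  qed
  then show ?thesis using G(1) by (simp add: normal_filter_def)
qed

lemma wajsberg_quotient_extends:
  assumes "wajsberg Q" "normal_filter A G" "F \<subseteq> G"
  shows "wajsberg (quotient_pbck A G)"
proof -
  interpret G: normal_quotient A G by unfold_locales (fact assms(2))
  have "G.cls a = G.cls b" if "cls a = cls b" "a \<in> carrier A" "b \<in> carrier A" for a b
    using that assms(3) by (auto simp: cls_eq_iff G.cls_eq_iff)
  then show ?thesis
    using assms(1) unfolding wajsberg_Q_iff G.wajsberg_Q_iff
    by (meson pimp_closed wimp_closed)
qed

text \<open>A class \<open>U\<close> other than \<open>\<one>\<close> generates a filter
  \<open>N\<close> whose preimage \<open>H\<close> properly contains \<open>F\<close>. Maximality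
  forces \<open>H\<close> to be everything, so \<open>N\<close> contains the zero class, which is
  the nilpotence required for linearity.\<close>

lemma linear_wajsberg_Q:
  assumes "wajsberg Q" "maximal_filter A F"
  shows "linear_wajsberg Q"
proof -
  interpret W: wajsberg Q by (fact assms(1))
  show ?thesis
  proof (rule W.linear_wajsberg_if_nilpotent)
    have "\<zero> \<notin> F"
      using assms(2) filter pbck_filter_eq_carrier_iff by (simp add: maximal_filter_def)
    then show "\<zero>\<^bsub>Q\<^esub> \<noteq> \<one>\<^bsub>Q\<^esub>" by (simp add: zero_Q one_Q cls_eq_one_iff)
  next
    fix U assume U: "U \<in> carrier Q" "U \<noteq> \<one>\<^bsub>Q\<^esub>"
    then obtain u where u: "u \<in> carrier A" "U = cls u" by (auto simp: carrier_Q)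
    then have "u \<notin> F" using U(2) by (simp add: one_Q cls_eq_one_iff)
    note u = u(1) this u(2)
    define N where "N = {X \<in> carrier Q. \<exists>n. ((\<rightharpoondown>\<^bsub>Q\<^esub>) U ^^ n) X = \<one>\<^bsub>Q\<^esub>}"
    have N: "pbck_filter Q N"
      unfolding N_def using u by (intro W.pbck_filter_funpow_pimp) (simp add: carrier_Q)
    define H where "H = {a \<in> carrier A. cls a \<in> N}"
    have "b \<in> H" if ab: "a \<in> H" "a \<rightharpoondown> b \<in> H" "b \<in> carrier A" for a b
    proof -
      have a: "a \<in> carrier A" "cls a \<in> N" "cls (a \<rightharpoondown> b) \<in> N"
        using ab unfolding H_def by blast+
      have "cls a \<rightharpoondown>\<^bsub>Q\<^esub> cls b \<in> N"
        using a ab(3) by (simp only: pimp_cls)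
      moreover have "cls b \<in> carrier Q"
        using ab(3) by (simp add: carrier_Q)
      ultimately have "cls b \<in> N" by (rule pbck_filter_mp[OF N a(2)])
      then show ?thesis using ab(3) unfolding H_def by blast
    qed
    moreover have FH: "F \<subseteq> H"
    proof
      fix a assume "a \<in> F"
      then have "a \<in> carrier A" "cls a = \<one>\<^bsub>Q\<^esub>" by (auto simp: mem_carrier one_Q cls_eq_one_iff)
      moreover have "\<one>\<^bsub>Q\<^esub> \<in> N" using N unfolding pbck_filter_def by blast
      ultimately show "a \<in> H" unfolding H_def by simp
    qed
    ultimately have "pbck_filter A H"
      using one_mem unfolding pbck_filter_def H_def by blast
    moreover have "u \<in> H"
    proof -
      have "((\<rightharpoondown>\<^bsub>Q\<^esub>) U ^^ 1) (cls u) = \<one>\<^bsub>Q\<^esub>"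
        using u by (simp add: carrier_Q)
      then have "cls u \<in> N" using u(1) unfolding N_def carrier_Q by blast
      then show ?thesis using u(1) by (simp add: H_def)
    qed
    ultimately have "H = carrier A"
      using assms(2) FH u(2) unfolding maximal_filter_def by blast
    then have "cls \<zero> \<in> N" using zero_closed unfolding H_def by blast
    then have "\<zero>\<^bsub>Q\<^esub> \<in> N" by (simp add: zero_Q)
    then show "\<exists>n. ((\<rightharpoondown>\<^bsub>Q\<^esub>) U ^^ n) \<zero>\<^bsub>Q\<^esub> = \<one>\<^bsub>Q\<^esub>" unfolding N_def by blast
  qed
qed

lemma bosbach_state_if_linear:
  assumes "linear_wajsberg Q"
  shows "\<exists>s. bosbach_state A s"
proof -
  interpret W: linear_wajsberg Q by (fact assms)
  have "bosbach_state A (\<lambda>a. W.rotation_number (cls a))"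
    using W.bosbach_state_rotation_number
    by (simp add: bosbach_state_def carrier_Q pimp_cls wimp_cls zero_Q one_Q)
  then show ?thesis by (intro exI)
qed

end

section \<open>Equivalence of the three conditions\<close>

theorem theorem3p30:
  fixes A :: "('a, 'm) bounded_pseudo_bck_scheme"
  assumes "bounded_pseudo_BCK A"
  shows "((\<exists>s. bosbach_state A s) \<longleftrightarrow>
            (\<exists>F. normal_filter A F \<and> F \<noteq> carrier A \<and> termwise_equiv_MV (quotient_pbck A F)))
       \<and> ((\<exists>F. normal_filter A F \<and> F \<noteq> carrier A \<and> termwise_equiv_MV (quotient_pbck A F)) \<longleftrightarrow>
            (\<exists>F. normal_filter A F \<and> maximal_filter A F \<and> termwise_equiv_MV (quotient_pbck A F)))"
    (is "(?a \<longleftrightarrow> ?b) \<and> (?b \<longleftrightarrow> ?c)")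
proof -
  interpret bounded_pseudo_BCK A by (fact assms)
  have quotient: "normal_quotient A F" if "normal_filter A F" for F
    using that by unfold_locales
  have ab: ?b if ?a
  proof -
    from that obtain s where "bosbach_state A s" ..
    then interpret bosbach A s by unfold_locales
    interpret K: normal_quotient A kernel by (rule quotient) (rule normal_filter_kernel)
    have "termwise_equiv_MV K.Q"
      using wajsberg_quotient_kernel by (simp add: K.termwise_equiv_MV_Q_iff)
    then show ?thesis using normal_filter_kernel kernel_neq_carrier by blast
  qed
  have bc: ?c if ?b
  proof -
    from that obtain F where F: "normal_filter A F" "F \<noteq> carrier A"
      "termwise_equiv_MV (quotient_pbck A F)" by blast
    interpret F: normal_quotient A F by (rule quotient) (fact F(1))
    have W: "wajsberg F.Q" using F(3) by (simp add: F.termwise_equiv_MV_Q_iff)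
    obtain G where G: "maximal_filter A G" "F \<subseteq> G"
      using maximal_filter_extends[OF F.filter F(2)] .
    have nG: "normal_filter A G"
      using F.normal_filter_extends[OF W] G by (simp add: maximal_filter_def)
    interpret G: normal_quotient A G by (rule quotient) (fact nG)
    have "termwise_equiv_MV G.Q"
      using F.wajsberg_quotient_extends[OF W nG G(2)] by (simp add: G.termwise_equiv_MV_Q_iff)
    then show ?thesis using nG G(1) by blast
  qed
  have ca: ?a if ?c
  proof -
    from that obtain F where F: "normal_filter A F" "maximal_filter A F"
      "termwise_equiv_MV (quotient_pbck A F)" by blast
    interpret F: normal_quotient A F by (rule quotient) (fact F(1))
    show ?thesis
      using F.bosbach_state_if_linear F.linear_wajsberg_Q F(2,3)
      by (simp add: F.termwise_equiv_MV_Q_iff)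
  qed
  have cb: ?b if ?c
    using that by (auto simp: maximal_filter_def)
  show ?thesis using ab bc ca cb by blast
qed

end
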